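(* Let $\mathbb{F}$ be any field and let $\mathbb{F}^{\square}$ be a transversal of $(\mathbb{F}^\ast)^2$ in $\mathbb{F}^\ast$. A complete set of representatives of the conjugacy classes in $\mathrm{AGL}_3(\mathbb{F})$ of the abelian regular subgroups of $\mathrm{AGL}_3(\mathbb{F})$ (each abelian regular subgroup is conjugate to exactly one member of the list) is given by the following subgroups, where $x_1,x_2,x_3$ range over $\mathbb{F}$: (1) $S_{(4)}=\left\{\begin{pmatrix}1&x_1&x_2&x_3\\0&1&x_1&x_2\\0&0&1&x_1\\0&0&0&1\end{pmatrix}\right\}$; (2) $S_{(3,1)}=\left\{\begin{pmatrix}1&x_1&x_2&x_3\\0&1&x_1&0\\0&0&1&0\\0&0&0&1\end{pmatrix}\right\}$; (3) $R_\lambda=\left\{\begin{pmatrix}1&x_1&x_2&x_3\\0&1&0&x_1\\0&0&1&\lambda x_2\\0&0&0&1\end{pmatrix}\right\}$, one for each $\lambda\in\mathbb{F}^{\square}$; (4) only when $\mathrm{char}\,\mathbb{F}=2$: $U_1^3=\left\{\begin{pmatrix}1&x_1&x_2&x_3\\0&1&0&x_2\\0&0&1&x_1\\0&0&0&1\end{pmatrix}\right\}$; (5) $S_{(2,1^2)}=\left\{\begin{pmatrix}1&x_1&x_2&x_3\\0&1&0&0\\0&0&1&0\\0&0&0&1\end{pmatrix}\right\}$. The corresponding algebras $\mathbb{F}I_4+U$ are isomorphic respectively to: (1) $\mathbb{F}[t_1]/\langle t_1^4\rangle$; (2) $\mathbb{F}[t_1,t_2]/\langle t_1^3,t_2^2,t_1t_2\rangle$;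 (3) $\mathbb{F}[t_1,t_2]/\langle t_1^2-\lambda t_2^2,t_1t_2\rangle$; (4) $\mathbb{F}[t_1,t_2]/\langle t_1^2,t_2^2\rangle$; (5) $\mathbb{F}[t_1,t_2,t_3]/\langle t_1,t_2,t_3\rangle^2$. The subgroups in (1), (3) and (4) are indecomposable.
   Context: $\mathrm{AGL}_n(\mathbb{F})$ is the subgroup of $\mathrm{GL}_{n+1}(\mathbb{F})$ consisting of the matrices with first column $(1,0,\dots,0)^{\mathrm T}$; $\pi:\mathrm{AGL}_n(\mathbb{F})\to\mathrm{GL}_n(\mathbb{F})$ sends $\begin{pmatrix}1&v\\0&A\end{pmatrix}$ to $A$. A subgroup $R\le\mathrm{AGL}_n(\mathbb{F})$ is regular if for every $v\in\mathbb{F}^n$ there is exactly one element of $R$ with first row $(1,v)$. A subgroup $H\le\mathrm{AGL}_n(\mathbb{F})$ is indecomposable if $\mathbb{F}^n$ is not a direct sum of non-trivial $\pi(H)$-invariant subspaces (acting on row vectors from the right). $\mathbb{F}I_{n+1}+U=\{\alpha I_{n+1}+\beta u:\alpha,\beta\in\mathbb{F},\ u\in U\}$. *)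

theory Defs
  imports
    "HOL-Library.Poly_Mapping"
    "HOL-Algebra.Group_Action"
    "HOL-Algebra.QuotRing"
    "HOL-Algebra.Ideal_Product"
    "Jordan_Normal_Form.VS_Connect"
begin

(* A field is a type 'a::field; its HOL-Algebra record is the library's class_ring. *)

definition is_transversal :: "('g, 'm) monoid_scheme \<Rightarrow> 'g set \<Rightarrow> 'g set \<Rightarrow> bool" where
  "is_transversal G H T \<longleftrightarrow>
     T \<subseteq> carrier G \<and> (\<forall>C \<in> rcosets\<^bsub>G\<^esub> H. \<exists>!t. t \<in> T \<inter> C)"

definition field_units :: "'a::field monoid" where
  "field_units = units_of class_ring"

definition unit_squares :: "'a::field set" where
  "unit_squares = {x \<otimes>\<^bsub>field_units\<^esub> x | x. x \<in> carrier field_units}"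

definition is_complete_set_of_reps :: "('b \<Rightarrow> 'b \<Rightarrow> bool) \<Rightarrow> 'b set \<Rightarrow> 'b set \<Rightarrow> bool" where
  "is_complete_set_of_reps rel X T \<longleftrightarrow> T \<subseteq> X \<and> (\<forall>x \<in> X. \<exists>!t. t \<in> T \<and> rel x t)"

definition conj_in :: "('g, 'm) monoid_scheme \<Rightarrow> 'g set \<Rightarrow> 'g set \<Rightarrow> bool" where
  "conj_in G H K \<longleftrightarrow>
     (\<exists>g \<in> carrier G. K = (\<lambda>h. g \<otimes>\<^bsub>G\<^esub> h \<otimes>\<^bsub>G\<^esub> inv\<^bsub>G\<^esub> g) ` H)"

definition GL :: "nat \<Rightarrow> 'a::field mat monoid" where
  "GL n = units_of (ring_mat TYPE('a) n ())"

definition AGL :: "nat \<Rightarrow> 'a::field mat monoid" where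
  "AGL n = (GL (n + 1)) \<lparr> carrier := {M \<in> carrier (GL (n + 1)). col M 0 = unit_vec (n + 1) 0} \<rparr>"

definition lin_part :: "'a mat \<Rightarrow> 'a::field mat" where
  "lin_part M = mat_delete M 0 0"

definition regular_subset :: "nat \<Rightarrow> 'a::field mat set \<Rightarrow> bool" where
  "regular_subset n R \<longleftrightarrow> (\<forall>v \<in> carrier_vec n. \<exists>!M. M \<in> R \<and> row M 0 = vCons 1 v)"

definition abelian_regular_subgroups :: "nat \<Rightarrow> 'a::field mat set set" where
  "abelian_regular_subgroups n =
     {R. subgroup R (AGL n) \<and> comm_group ((AGL n) \<lparr> carrier := R \<rparr>) \<and> regular_subset n R}"

(* The right action w A on row vectors. *)
definition row_vec_mult :: "'a vec \<Rightarrow> 'a mat \<Rightarrow> 'a::field vec" where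
  "row_vec_mult w A = vec (dim_col A) (\<lambda>j. w \<bullet> col A j)"

definition invariant_subspace :: "nat \<Rightarrow> 'a::field mat set \<Rightarrow> 'a vec set \<Rightarrow> bool" where
  "invariant_subspace n H W \<longleftrightarrow>
     subspace class_ring W (module_vec TYPE('a) n) \<and>
     (\<forall>h \<in> H. \<forall>w \<in> W. row_vec_mult w (lin_part h) \<in> W)"

(* A direct sum of several non-trivial invariant subspaces can be regrouped into two. *)
definition indecomposable :: "nat \<Rightarrow> 'a::field mat set \<Rightarrow> bool" where
  "indecomposable n H \<longleftrightarrow>
     \<not> (\<exists>V W. invariant_subspace n H V \<and> invariant_subspace n H W \<and>
          V \<noteq> {0\<^sub>v n} \<and> W \<noteq> {0\<^sub>v n} \<and>
          V \<inter> W = {0\<^sub>v n} \<and> {v + w | v w. v \<in> V \<and> w \<in> W} = carrier_vec n)"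

(* ring_iso does not require its arguments to be rings, hence the two algebra conjuncts. *)
definition alg_isomorphic ::
  "('a, 'k) ring_scheme \<Rightarrow> ('a, 'b) module \<Rightarrow> ('a, 'c) module \<Rightarrow> bool" where
  "alg_isomorphic K A B \<longleftrightarrow>
     algebra K A \<and> algebra K B \<and>
     (\<exists>f \<in> ring_iso A B. \<forall>c \<in> carrier K. \<forall>x \<in> carrier A. f (c \<odot>\<^bsub>A\<^esub> x) = c \<odot>\<^bsub>B\<^esub> f x)"

definition scalars_plus :: "nat \<Rightarrow> 'a::field mat set \<Rightarrow> ('a, 'a mat) module" where
  "scalars_plus n U =
     \<lparr> carrier = {a \<cdot>\<^sub>m 1\<^sub>m n + b \<cdot>\<^sub>m u | a b u. u \<in> U},
       mult = (*), one = 1\<^sub>m n, zero = 0\<^sub>m n n, add = (+), smult = (\<cdot>\<^sub>m) \<rparr>"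

(* A polynomial maps monomials to coefficients; a monomial maps i to the exponent of t_i. *)
type_synonym 'a mpolynomial = "(nat \<Rightarrow>\<^sub>0 nat) \<Rightarrow>\<^sub>0 'a"

definition t_var :: "nat \<Rightarrow> 'a::field mpolynomial" where
  "t_var i = Poly_Mapping.single (Poly_Mapping.single i 1) 1"

definition t_const :: "'a \<Rightarrow> 'a::field mpolynomial" where
  "t_const c = Poly_Mapping.single 0 c"

(* The polynomial algebra in the k variables t_1, ..., t_k. *)
definition poly_alg :: "nat \<Rightarrow> ('a::field, 'a mpolynomial) module" where
  "poly_alg k =
     \<lparr> carrier = {p. \<forall>m \<in> Poly_Mapping.keys p. Poly_Mapping.keys m \<subseteq> {1..k}},
       mult = (*), one = 1, zero = 0, add = (+), smult = (\<lambda>c p. t_const c * p) \<rparr>"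

(* c acts on a coset x + I as c x + I; the union is over equal cosets. *)
definition quot_alg :: "('a, 'b) module \<Rightarrow> 'b set \<Rightarrow> ('a, 'b set) module" where
  "quot_alg A I =
     \<lparr> carrier = carrier (A Quot I), mult = mult (A Quot I), one = one (A Quot I),
       zero = zero (A Quot I), add = add (A Quot I),
       smult = (\<lambda>c X. \<Union>x \<in> X. I +>\<^bsub>A\<^esub> (c \<odot>\<^bsub>A\<^esub> x)) \<rparr>"

definition poly_quot ::
  "nat \<Rightarrow> 'a::field mpolynomial set \<Rightarrow> ('a, 'a mpolynomial set) module" where
  "poly_quot k S = quot_alg (poly_alg k) (Idl\<^bsub>poly_alg k\<^esub> S)"

definition S_4 :: "'a::field mat set" where
  "S_4 = {mat_of_rows_list 4
     [[1, x1, x2, x3],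
      [0,  1, x1, x2],
      [0,  0,  1, x1],
      [0,  0,  0,  1]] | x1 x2 x3. True}"

definition S_31 :: "'a::field mat set" where
  "S_31 = {mat_of_rows_list 4
     [[1, x1, x2, x3],
      [0,  1, x1,  0],
      [0,  0,  1,  0],
      [0,  0,  0,  1]] | x1 x2 x3. True}"

definition R_sub :: "'a \<Rightarrow> 'a::field mat set" where
  "R_sub l = {mat_of_rows_list 4
     [[1, x1, x2, x3],
      [0,  1,  0, x1],
      [0,  0,  1, l * x2],
      [0,  0,  0,  1]] | x1 x2 x3. True}"

definition U_13 :: "'a::field mat set" where
  "U_13 = {mat_of_rows_list 4
     [[1, x1, x2, x3],
      [0,  1,  0, x2],
      [0,  0,  1, x1],
      [0,  0,  0,  1]] | x1 x2 x3. True}"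

definition S_211 :: "'a::field mat set" where
  "S_211 = {mat_of_rows_list 4
     [[1, x1, x2, x3],
      [0,  1,  0,  0],
      [0,  0,  1,  0],
      [0,  0,  0,  1]] | x1 x2 x3. True}"

end

theory Submission
  imports Defs "HOL-Library.Product_Plus"
begin

text \<open>For an abelian regular subgroup, write \<open>M\<^sub>v\<close> for its element with first row \<open>(1, v)\<close>, and let
  \<open>v w = v (\<pi>(M\<^sub>w) - I)\<close>. Commutativity makes this product bilinear, so \<open>F\<^sup>3\<close> becomes a commutative
  associative algebra in which \<open>v w = v\<close> forces \<open>v = 0\<close>, and conjugacy becomes isomorphism of algebras.
  If some cube \<open>v\<^sup>3\<close> is nonzero then \<open>v, v\<^sup>2, v\<^sup>3\<close> is a basis. Otherwise, if some square \<open>v\<^sup>2\<close> is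
  nonzero, the product is a diagonal form \<open>x\<^sub>1 y\<^sub>1 + b x\<^sub>2 y\<^sub>2\<close> with values in the line of \<open>v\<^sup>2\<close>, and \<open>b\<close>
  is determined up to squares by the discriminant. If all squares vanish then \<open>2 v w = 0\<close>, and a
  nonzero product can only exist in characteristic 2.\<close>

section \<open>Three-dimensional commutative algebras\<close>

text \<open>The product is linear in \<open>v\<close> by construction; commutativity carries this
  over to \<open>w\<close>, and closure of the group gives associativity, since the product of the
  elements for \<open>v\<close> and \<open>w\<close> is the element for \<open>v + w + v w\<close>.
  In place of nilpotency stands the condition that \<open>v w = c v\<close> with
  \<open>c \<noteq> 0\<close> forces \<open>v = 0\<close>. It expresses invertibility of the
  matrices, and it is what removes unwanted coefficients one after another. All five types fit one
  multiplication table with four constants, so regularity, conjugacy, indecomposability and the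
  criterion for the presentations are proved once, for the family \<open>fam a p q r\<close>. A
  conjugating matrix transports products of the matrices \<open>M - 1\<close>, so types are
  separated by which cubes, squares and products vanish, and two groups \<open>R_sub\<close> by a
  Gram determinant, in every characteristic alike. Outside characteristic 2 the group
  \<open>U_13\<close> is a disguised member of the third type: on \<open>e1 + e2\<close> and
  \<open>e1 - e2\<close> its product is diagonal with entries 2 and -2.\<close>

locale quasi_regular_algebra = finite_dimensional_vector_space scale Basis
  for scale :: "'a::field \<Rightarrow> 'b::ab_group_add \<Rightarrow> 'b" (infixr \<open>*s\<close> 75) and Basis +
  fixes mul :: "'b \<Rightarrow> 'b \<Rightarrow> 'b" (infixl \<open>\<star>\<close> 70)
  assumes mul_comm: "x \<star> y = y \<star> x"
    and mul_assoc: "(x \<star> y) \<star> z = x \<star> (y \<star> z)"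
    and mul_add_left: "(x + y) \<star> z = x \<star> z + y \<star> z"
    and mul_scale_left: "(c *s x) \<star> y = c *s (x \<star> y)"
    and mul_fixed: "x \<star> y = x \<Longrightarrow> x = 0"
    and dim3: "card Basis = 3"
begin

text \<open>Independence of the triple, not of the set \<open>{u, v, w}\<close>: repeated vectors
  are excluded, and coefficients can be compared position by position.\<close>

definition free3 :: "'b \<Rightarrow> 'b \<Rightarrow> 'b \<Rightarrow> bool" where
  "free3 u v w \<longleftrightarrow> (\<forall>a b c. a *s u + b *s v + c *s w = 0 \<longrightarrow> a = 0 \<and> b = 0 \<and> c = 0)"

text \<open>The parameters \<open>a p q r\<close> are structure constants. The values
  \<open>1 0 1 0\<close>, \<open>1 0 0 0\<close>, \<open>0 1 0 r\<close> with
  \<open>r \<noteq> 0\<close>, \<open>0 0 1 0\<close> and \<open>0 0 0 0\<close> are the normal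
  forms behind \<open>S_4\<close>, \<open>S_31\<close>, \<open>R_sub\<close>, \<open>U_13\<close>
  and \<open>S_211\<close>.\<close>

definition table :: "'b \<Rightarrow> 'b \<Rightarrow> 'b \<Rightarrow> 'a \<Rightarrow> 'a \<Rightarrow> 'a \<Rightarrow> 'a \<Rightarrow> bool" where
  "table u1 u2 u3 a p q r \<longleftrightarrow> free3 u1 u2 u3 \<and>
     u1 \<star> u1 = a *s u2 + p *s u3 \<and> u1 \<star> u2 = q *s u3 \<and> u2 \<star> u2 = r *s u3 \<and>
     u3 \<star> u1 = 0 \<and> u3 \<star> u2 = 0 \<and> u3 \<star> u3 = 0"

lemma mul_add_right: "z \<star> (x + y) = z \<star> x + z \<star> y"
  by (simp add: mul_comm[of z] mul_add_left)

lemma mul_scale_right: "y \<star> (c *s x) = c *s (y \<star> x)"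
  by (simp add: mul_comm[of y] mul_scale_left)

lemma mul_0_left [simp]: "0 \<star> x = 0"
  using mul_scale_left[of 0 0 x] by simp

lemma mul_0_right [simp]: "x \<star> 0 = 0"
  by (simp add: mul_comm[of x])

lemma mul_left_comm: "x \<star> (y \<star> z) = y \<star> (x \<star> z)"
  by (metis mul_assoc mul_comm)

lemmas mul_ac = mul_assoc mul_comm mul_left_comm

lemma mul_diff_right: "x \<star> (y - z) = x \<star> y - x \<star> z"
  using mul_add_right[of x "y - z" z] by simp

lemmas mul_linear = mul_add_left mul_add_right mul_diff_right mul_scale_left mul_scale_right

section \<open>Independent triples in dimension three\<close>

lemma free3_independent:
  assumes "free3 u v w"
  shows "independent {u, v, w}" "card {u, v, w} = 3"
proof -
  have u: "u \<notin> span {}"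
    using assms[unfolded free3_def, rule_format, of 1 0 0] by auto
  have v: "v \<notin> span {u}"
  proof
    assume "v \<in> span {u}"
    then obtain k where "v = k *s u" by (auto simp: span_singleton)
    with assms[unfolded free3_def, rule_format, of k "-1" 0] show False by simp
  qed
  have w: "w \<notin> span {v, u}"
  proof
    assume "w \<in> span {v, u}"
    then obtain k where "w - k *s v \<in> span {u}" by (auto simp: span_insert)
    then obtain l where "w - k *s v = l *s u" by (auto simp: span_singleton)
    then have "w = l *s u + k *s v" by (simp add: diff_eq_eq)
    then have "l *s u + k *s v + (-1) *s w = 0" by simp
    with assms[unfolded free3_def, rule_format, of l k "-1"] show False by simp
  qed
  have "independent {u}" using u by simp
  then have "independent {v, u}" by (rule independent_insertI[OF v])
  then have "independent {w, v, u}" by (rule independent_insertI[OF w])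
  then show "independent {u, v, w}" by (simp add: insert_commute)
  have "u \<noteq> v" "w \<noteq> u" "w \<noteq> v" using v w by (auto intro: span_base)
  then show "card {u, v, w} = 3" by auto
qed

lemma free3_spans:
  assumes "free3 u v w"
  shows "\<exists>a b c. x = a *s u + b *s v + c *s w"
proof -
  have "UNIV \<subseteq> span {u, v, w}"
    using free3_independent[OF assms] by (intro card_ge_dim_independent) (auto simp: dim3)
  then have "x \<in> span {u, v, w}" by blast
  then obtain a b where "x - a *s u - b *s v \<in> span {w}" by (auto simp: span_insert)
  then obtain c where "x - a *s u - b *s v = c *s w" by (auto simp: span_singleton)
  then have "x = a *s u + b *s v + c *s w" by (simp add: algebra_simps)
  then show ?thesis by blast
qed

text \<open>Two vectors span dimension at most 2, so some vector lies outside their span, and any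
  such vector will do.\<close>

lemma extend_to_free3:
  assumes "\<And>a b. a *s u + b *s v = 0 \<Longrightarrow> a = 0 \<and> b = 0"
  shows "\<exists>w. free3 u v w"
proof -
  have "dim (span {u, v}) \<le> 2"
    using dim_le_card[of "span {u, v}" "{u, v}"] card_insert_le_m1[of 2 "{v}" u] by auto
  then have "span {u, v} \<noteq> UNIV" using dim_UNIV dim3 by (metis Suc_n_not_le_n eval_nat_numeral(3))
  then obtain w where w: "w \<notin> span {u, v}" by blast
  have "free3 u v w" unfolding free3_def
  proof (intro allI impI)
    fix a b c assume eq: "a *s u + b *s v + c *s w = 0"
    have "c = 0"
    proof (rule ccontr)
      assume "c \<noteq> 0"
      have "c *s w = - (a *s u + b *s v)" using eq by (metis add.inverse_unique)
      then have "c *s w \<in> span {u, v}"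
        by (metis span_add span_base span_neg span_scale insertCI)
      then have "inverse c *s (c *s w) \<in> span {u, v}" by (rule span_scale)
      with \<open>c \<noteq> 0\<close> w show False by simp
    qed
    with eq assms[of a b] show "a = 0 \<and> b = 0 \<and> c = 0" by simp
  qed
  then show ?thesis by blast
qed

section \<open>Classification by vanishing of cubes, squares and products\<close>

text \<open>Dividing \<open>y\<close> by \<open>c\<close> reduces this to \<open>mul_fixed\<close>.
  It says that multiplication by \<open>y\<close> has no nonzero eigenvalue.\<close>

lemma mul_fixed_scaled:
  assumes "c *s x = x \<star> y" "c \<noteq> 0"
  shows "x = 0"
proof (rule mul_fixed)
  show "x \<star> (inverse c *s y) = x"
    by (simp add: mul_scale_right assms(1)[symmetric] assms(2))
qed

lemma classify_cube_nonzero: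
  assumes "v \<star> v \<star> v \<noteq> 0"
  shows "table v (v \<star> v) (v \<star> v \<star> v) 1 0 1 0"
proof -
  let ?z = "v \<star> v" and ?t = "v \<star> v \<star> v"
  have nz: "v \<noteq> 0" "?z \<noteq> 0" using assms by auto
  \<comment> \<open>In such a relation the term of lowest degree is a product of that power of
    \<open>v\<close> with something, so its coefficient must vanish. The term
    \<open>d *s (?t \<star> v)\<close> lets one argument serve twice: \<open>d = 0\<close> gives
    independence of the three powers, \<open>d = 1\<close> shows that the fourth power, once
    expanded in them, is zero.\<close>
  have low: "a = 0 \<and> b = 0 \<and> c = 0" if eq: "a *s v + b *s ?z + c *s ?t = d *s (?t \<star> v)" for a b c d
  proof -
    have a: "a = 0"
    proof (rule ccontr)
      assume "a \<noteq> 0"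
      have "a *s v = d *s (?t \<star> v) - b *s ?z - c *s ?t" using eq by (simp add: algebra_simps)
      also have "\<dots> = v \<star> (d *s ?t + (- b) *s v + (- c) *s ?z)"
        by (simp add: mul_linear mul_ac)
      finally show False using mul_fixed_scaled \<open>a \<noteq> 0\<close> nz by blast
    qed
    have b: "b = 0"
    proof (rule ccontr)
      assume "b \<noteq> 0"
      have "b *s ?z = d *s (?t \<star> v) - c *s ?t" using eq a by (simp add: algebra_simps)
      also have "\<dots> = ?z \<star> (d *s ?z + (- c) *s v)"
        by (simp add: mul_linear mul_ac)
      finally show False using mul_fixed_scaled \<open>b \<noteq> 0\<close> nz by blast
    qed
    have "c = 0"
    proof (rule ccontr)
      assume "c \<noteq> 0"
      have "c *s ?t = ?t \<star> (d *s v)" using eq a b by (simp add: mul_linear)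
      then show False using mul_fixed_scaled \<open>c \<noteq> 0\<close> assms by blast
    qed
    with a b show ?thesis by simp
  qed
  have free: "free3 v ?z ?t" unfolding free3_def using low[of _ _ _ 0] by simp
  obtain a b c where abc: "?t \<star> v = a *s v + b *s ?z + c *s ?t"
    using free3_spans[OF free] by blast
  with low[of a b c 1] have t: "?t \<star> v = 0" by simp
  then have "?z \<star> ?z = 0" by (simp add: mul_assoc)
  moreover have "?t \<star> ?z = 0" using t by (metis mul_assoc mul_0_left)
  moreover have "?t \<star> ?t = 0" using t by (metis mul_assoc mul_comm mul_0_left)
  ultimately show ?thesis unfolding table_def using free t by (simp add: mul_comm)
qed

text \<open>The aim is a vector \<open>w\<close> orthogonal to \<open>v\<close> whose square lies on
  the line of \<open>v \<star> v\<close>. Any complement of the span of \<open>v\<close> and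
  \<open>v \<star> v\<close> can be corrected to such a \<open>w\<close>.\<close>

lemma classify_cube_zero:
  assumes cube: "\<And>x. x \<star> x \<star> x = 0" and v: "v \<star> v \<noteq> 0"
  shows "\<exists>w r. table v w (v \<star> v) 0 1 0 r"
proof -
  let ?z = "v \<star> v"
  have zv: "?z \<star> v = 0" "v \<star> ?z = 0" using cube[of v] by (simp_all add: mul_comm)
  have "a = 0 \<and> b = 0" if eq: "a *s v + b *s ?z = 0" for a b
  proof -
    have "v \<star> (a *s v + b *s ?z) = 0" using eq by simp
    then have "a = 0" using v by (simp add: mul_linear zv)
    with eq v show ?thesis by simp
  qed
  then obtain w0 where free0: "free3 v ?z w0" using extend_to_free3 by blast
  obtain a b c where w0: "v \<star> w0 = a *s v + b *s ?z + c *s w0"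
    using free3_spans[OF free0] by blast
  \<comment> \<open>Multiplication by \<open>v\<close> is nilpotent, so its diagonal coefficient
    \<open>c\<close> at \<open>w0\<close> vanishes: the \<open>w0\<close>-coordinate of the triple
    product is \<open>c * c * c\<close>.\<close>
  have cube_w0: "v \<star> (v \<star> (v \<star> w0)) = 0"
    using cube[of v] by (metis mul_assoc mul_0_left)
  have "v \<star> (v \<star> (v \<star> w0)) = (c * c * a) *s v + (c * a + c * c * b) *s ?z + (c * c * c) *s w0"
    by (simp add: w0 mul_linear zv algebra_simps)
  then have c: "c = 0" using free0 cube_w0 unfolding free3_def by (metis mult_eq_0_iff)
  \<comment> \<open>An orthogonalisation step: since \<open>v \<star> v\<close> is
    \<open>?z\<close>, subtracting \<open>b *s v\<close> cancels the component
    \<open>b *s ?z\<close> of \<open>v \<star> w0\<close>.\<close>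
  define w where "w = w0 - b *s v"
  have vw_a: "v \<star> w = a *s v"
    using w0 c mul_add_right[of v w "b *s v"] by (simp add: w_def mul_scale_right)
  have "v \<noteq> 0" using v by auto
  then have a: "a = 0" using mul_fixed_scaled[of a v w] vw_a by metis
  then have vw: "v \<star> w = 0" "w \<star> v = 0" using vw_a by (simp_all add: mul_comm)
  have free: "free3 v w ?z" unfolding free3_def
  proof (intro allI impI)
    fix x y t assume eq: "x *s v + y *s w + t *s ?z = 0"
    then have "(x - y * b) *s v + t *s ?z + y *s w0 = 0"
      by (simp add: w_def algebra_simps)
    then have "x - y * b = 0 \<and> t = 0 \<and> y = 0" using free0 unfolding free3_def by blast
    then show "x = 0 \<and> y = 0 \<and> t = 0" by simp
  qed
  have wz: "?z \<star> w = 0" using vw by (simp add: mul_assoc)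
  obtain \<alpha> \<gamma> \<beta> where ww: "w \<star> w = \<alpha> *s v + \<gamma> *s w + \<beta> *s ?z"
    using free3_spans[OF free] by blast
  \<comment> \<open>Multiplying the square of \<open>w\<close> by \<open>v\<close> isolates
    \<alpha>; multiplying it by \<open>w\<close> isolates \<gamma>, because cubes vanish.\<close>
  have "0 = v \<star> (w \<star> w)" using vw by (metis mul_assoc mul_0_left)
  also have "\<dots> = \<alpha> *s ?z" by (simp add: ww mul_linear vw zv)
  finally have \<alpha>: "\<alpha> = 0" using v by simp
  have "0 = w \<star> w \<star> w" by (simp add: cube)
  also have "\<dots> = \<gamma> *s (w \<star> w)" by (simp add: ww \<alpha> mul_linear wz)
  finally have "\<gamma> = 0"
    using free ww \<alpha> unfolding free3_def by (metis scale_eq_0_iff scale_zero_left add_0)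
  then have ww': "w \<star> w = \<beta> *s ?z" using ww \<alpha> by simp
  have "?z \<star> ?z = 0" using zv by (simp add: mul_assoc)
  then have "table v w ?z 0 1 0 \<beta>"
    unfolding table_def using free zv vw wz ww' by simp
  then show ?thesis by blast
qed

text \<open>Scaling the second vector multiplies its square by \<open>s * s\<close>. This moves the
  last constant to the representative of its square class.\<close>

lemma table_rescale:
  assumes "table u v w 0 1 0 r" "s \<noteq> 0"
  shows "table u (s *s v) w 0 1 0 (s * s * r)"
proof -
  have "free3 u (s *s v) w" unfolding free3_def
  proof (intro allI impI)
    fix a b c assume "a *s u + b *s s *s v + c *s w = 0"
    then have "a *s u + (b * s) *s v + c *s w = 0" by simp
    then have "a = 0 \<and> b * s = 0 \<and> c = 0"
      using assms(1) unfolding table_def free3_def by blast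
    with assms(2) show "a = 0 \<and> b = 0 \<and> c = 0" by simp
  qed
  with assms show ?thesis unfolding table_def by (simp add: mul_linear mult.assoc)
qed

text \<open>With a degenerate form the second vector annihilates everything, so it can trade places
  with the square of the first and the normal form of \<open>S_31\<close> appears.\<close>

lemma table_split_square:
  assumes "table u v w 0 1 0 0"
  shows "table u w v 1 0 0 0"
proof -
  have "free3 u w v" unfolding free3_def
  proof (intro allI impI)
    fix a b c assume "a *s u + b *s w + c *s v = 0"
    then have "a *s u + c *s v + b *s w = 0" by (simp add: add_ac)
    then show "a = 0 \<and> b = 0 \<and> c = 0" using assms unfolding table_def free3_def by blast
  qed
  with assms show ?thesis unfolding table_def by (simp add: mul_ac)
qed

text \<open>Polarising the square of \<open>v + w\<close> gives characteristic 2. Multiplying a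
  linear relation by \<open>v\<close> and by \<open>w\<close> isolates its first two coefficients,
  which proves independence.\<close>

lemma classify_squares_zero:
  assumes sq: "\<And>x. x \<star> x = 0" and nz: "v \<star> w \<noteq> 0"
  shows "table v w (v \<star> w) 0 0 1 0" "(2::'a) = 0"
proof -
  let ?z = "v \<star> w"
  have "0 = (v + w) \<star> (v + w)" by (simp add: sq)
  also have "\<dots> = ?z + ?z" unfolding mul_add_left mul_add_right by (simp add: sq mul_comm)
  also have "\<dots> = 2 *s ?z" using scale_left_distrib[of 1 1 ?z] by simp
  finally show "(2::'a) = 0" using nz by simp
  have z: "v \<star> ?z = 0" "w \<star> ?z = 0" "?z \<star> ?z = 0"
    using sq by (metis mul_assoc mul_comm mul_0_left)+
  have "free3 v w ?z" unfolding free3_def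
  proof (intro allI impI)
    fix a b c assume eq: "a *s v + b *s w + c *s ?z = 0"
    have "v \<star> (a *s v + b *s w + c *s ?z) = 0" "w \<star> (a *s v + b *s w + c *s ?z) = 0"
      using eq by simp_all
    then have "b = 0" "a = 0" using nz by (simp_all add: mul_linear z sq mul_comm[of w v])
    with eq nz show "a = 0 \<and> b = 0 \<and> c = 0" by simp
  qed
  then show "table v w ?z 0 0 1 0"
    unfolding table_def using z by (simp add: sq mul_comm)
qed

lemma classify_zero:
  assumes "\<And>x y. x \<star> y = 0"
  shows "\<exists>u v w. table u v w 0 0 0 0"
proof -
  obtain u v w where "Basis = {u, v, w}" "u \<noteq> v" "u \<noteq> w" "v \<noteq> w"
    using dim3 by (auto simp: card_3_iff)
  then have *: "u \<noteq> v" "u \<noteq> w" "v \<noteq> w" "independent {u, v, w}"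
    using independent_Basis by auto
  have "free3 u v w" unfolding free3_def
  proof (intro allI impI)
    fix a b c assume "a *s u + b *s v + c *s w = 0"
    then have "(\<Sum>x\<in>{u,v,w}. (if x = u then a else if x = v then b else c) *s x) = 0"
      using * by (simp add: algebra_simps)
    note sum = this
    have "(if x = u then a else if x = v then b else c) = 0" if "x \<in> {u, v, w}" for x
      using *(4)[unfolded independent_explicit_finite_subsets, rule_format, OF subset_refl _ sum that]
      by simp
    from this[of u] this[of v] this[of w]
    show "a = 0 \<and> b = 0 \<and> c = 0" using *(1-3) by simp
  qed
  then show ?thesis unfolding table_def using assms by auto
qed

text \<open>Cubes, squares and products are tested in this order. The degenerate case
  \<open>r = 0\<close> of the diagonal form joins the second alternative.\<close>

theorem classification:
  "(\<exists>u v w. table u v w 1 0 1 0) \<or> (\<exists>u v w. table u v w 1 0 0 0) \<or>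
   (\<exists>u v w. table u v w 0 0 0 0) \<or> (\<exists>u v w r. r \<noteq> 0 \<and> table u v w 0 1 0 r) \<or>
   ((2::'a) = 0 \<and> (\<exists>u v w. table u v w 0 0 1 0))"
proof -
  consider v where "v \<star> v \<star> v \<noteq> 0"
    | v where "\<And>x. x \<star> x \<star> x = 0" "v \<star> v \<noteq> 0"
    | v w where "\<And>x. x \<star> x = 0" "v \<star> w \<noteq> 0"
    | "\<And>x y. x \<star> y = 0" by blast
  then show ?thesis
  proof cases
    case 1
    then show ?thesis using classify_cube_nonzero by blast
  next
    case 2
    then obtain w r where "table v w (v \<star> v) 0 1 0 r" using classify_cube_zero by blast
    then show ?thesis using table_split_square by (cases "r = 0") blast+
  next
    case 3
    then show ?thesis using classify_squares_zero by blast
  next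
    case 4
    then show ?thesis using classify_zero by blast
  qed
qed

end

section \<open>The affine group and its upper triangular subgroups\<close>

context group
begin

text \<open>Conjugacy as an intertwining relation. It contains no inverse, so for matrices it can be
  checked entry by entry or on a basis.\<close>

lemma conj_in_iff:
  assumes "H \<subseteq> carrier G" "K \<subseteq> carrier G"
  shows "conj_in G H K \<longleftrightarrow>
    (\<exists>g \<in> carrier G. (\<forall>h \<in> H. \<exists>k \<in> K. g \<otimes> h = k \<otimes> g) \<and> (\<forall>k \<in> K. \<exists>h \<in> H. g \<otimes> h = k \<otimes> g))"
    (is "_ \<longleftrightarrow> (\<exists>g \<in> carrier G. ?P g)")
proof -
  have *: "g \<otimes> h \<otimes> inv g = k \<longleftrightarrow> g \<otimes> h = k \<otimes> g" if "g \<in> carrier G" "h \<in> H" "k \<in> carrier G" for g h k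
    using that assms inv_solve_right[of k "g \<otimes> h" g] by (auto simp: subset_iff)
  have "K = (\<lambda>h. g \<otimes> h \<otimes> inv g) ` H \<longleftrightarrow> ?P g" if g: "g \<in> carrier G" for g
  proof
    assume K: "K = (\<lambda>h. g \<otimes> h \<otimes> inv g) ` H"
    show "?P g"
    proof (intro conjI ballI)
      fix h assume h: "h \<in> H"
      with K have "g \<otimes> h \<otimes> inv g \<in> K" by blast
      with * g h assms show "\<exists>k \<in> K. g \<otimes> h = k \<otimes> g" by blast
    next
      fix k assume k: "k \<in> K"
      with K obtain h where "h \<in> H" "g \<otimes> h \<otimes> inv g = k" by blast
      with * g k assms show "\<exists>h \<in> H. g \<otimes> h = k \<otimes> g" by blast
    qed
  next
    assume P: "?P g"
    show "K = (\<lambda>h. g \<otimes> h \<otimes> inv g) ` H"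
    proof (intro subset_antisym subsetI)
      fix k assume k: "k \<in> K"
      with P obtain h where "h \<in> H" "g \<otimes> h = k \<otimes> g" by blast
      with * g k assms show "k \<in> (\<lambda>h. g \<otimes> h \<otimes> inv g) ` H" by blast
    next
      fix x assume "x \<in> (\<lambda>h. g \<otimes> h \<otimes> inv g) ` H"
      then obtain h where h: "h \<in> H" "x = g \<otimes> h \<otimes> inv g" by blast
      with P obtain k where "k \<in> K" "g \<otimes> h = k \<otimes> g" by blast
      with * g h assms show "x \<in> K" by blast
    qed
  qed
  then show ?thesis unfolding conj_in_def by blast
qed

lemma conj_in_sym:
  assumes HK: "H \<subseteq> carrier G" "K \<subseteq> carrier G" and "conj_in G H K"
  shows "conj_in G K H"
proof -
  obtain g where g: "g \<in> carrier G"
    and 1: "\<And>h. h \<in> H \<Longrightarrow> \<exists>k \<in> K. g \<otimes> h = k \<otimes> g"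
    and 2: "\<And>k. k \<in> K \<Longrightarrow> \<exists>h \<in> H. g \<otimes> h = k \<otimes> g"
    using assms(3) conj_in_iff[OF HK] by blast
  have *: "inv g \<otimes> k = h \<otimes> inv g" if "h \<in> H" "k \<in> K" "g \<otimes> h = k \<otimes> g" for h k
  proof -
    have c: "h \<in> carrier G" "k \<in> carrier G" using that HK by auto
    have "inv g \<otimes> k = inv g \<otimes> (k \<otimes> g) \<otimes> inv g" using c g by (simp add: m_assoc)
    also have "\<dots> = inv g \<otimes> (g \<otimes> h) \<otimes> inv g" by (simp add: that(3))
    also have "\<dots> = h \<otimes> inv g" using c g by (simp add: m_assoc[symmetric])
    finally show ?thesis .
  qed
  show ?thesis unfolding conj_in_iff[OF HK(2,1)]
  proof (rule bexI[of _ "inv g"], intro conjI ballI)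
    fix k assume "k \<in> K"
    then show "\<exists>h \<in> H. inv g \<otimes> k = h \<otimes> inv g" using 2 * by blast
  next
    fix h assume "h \<in> H"
    then show "\<exists>k \<in> K. inv g \<otimes> k = h \<otimes> inv g" using 1 * by blast
  qed (use g in simp)
qed

lemma conj_in_trans:
  assumes c: "H \<subseteq> carrier G" "K \<subseteq> carrier G" "L \<subseteq> carrier G" and "conj_in G H K" "conj_in G K L"
  shows "conj_in G H L"
proof -
  obtain g where g: "g \<in> carrier G"
    and g1: "\<And>h. h \<in> H \<Longrightarrow> \<exists>k \<in> K. g \<otimes> h = k \<otimes> g"
    and g2: "\<And>k. k \<in> K \<Longrightarrow> \<exists>h \<in> H. g \<otimes> h = k \<otimes> g"
    using assms(4) conj_in_iff[OF c(1,2)] by blast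
  obtain f where f: "f \<in> carrier G"
    and f1: "\<And>h. h \<in> K \<Longrightarrow> \<exists>k \<in> L. f \<otimes> h = k \<otimes> f"
    and f2: "\<And>k. k \<in> L \<Longrightarrow> \<exists>h \<in> K. f \<otimes> h = k \<otimes> f"
    using assms(5) conj_in_iff[OF c(2,3)] by blast
  have *: "f \<otimes> g \<otimes> h = l \<otimes> (f \<otimes> g)"
    if "h \<in> H" "k \<in> K" "l \<in> L" "g \<otimes> h = k \<otimes> g" "f \<otimes> k = l \<otimes> f" for h k l
  proof -
    have cc: "h \<in> carrier G" "k \<in> carrier G" "l \<in> carrier G" using that c by auto
    have "f \<otimes> g \<otimes> h = f \<otimes> k \<otimes> g" using cc f g by (simp add: m_assoc that(4))
    also have "\<dots> = l \<otimes> (f \<otimes> g)" using cc f g by (simp add: m_assoc that(5))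
    finally show ?thesis .
  qed
  show ?thesis unfolding conj_in_iff[OF c(1,3)]
  proof (rule bexI[of _ "f \<otimes> g"], intro conjI ballI)
    fix h assume h: "h \<in> H"
    then obtain k where k: "k \<in> K" "g \<otimes> h = k \<otimes> g" using g1 by blast
    then obtain l where "l \<in> L" "f \<otimes> k = l \<otimes> f" using f1 by blast
    then show "\<exists>l \<in> L. f \<otimes> g \<otimes> h = l \<otimes> (f \<otimes> g)" using * h k by blast
  next
    fix l assume l: "l \<in> L"
    then obtain k where k: "k \<in> K" "f \<otimes> k = l \<otimes> f" using f2 by blast
    then obtain h where "h \<in> H" "g \<otimes> h = k \<otimes> g" using g2 by blast
    then show "\<exists>h \<in> H. f \<otimes> g \<otimes> h = l \<otimes> (f \<otimes> g)" using * l k by blast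
  qed (use f g in simp)
qed

end

section \<open>General linear and affine groups of matrices\<close>

lemma carrier_GL:
  "M \<in> carrier (GL n) \<longleftrightarrow>
     M \<in> carrier_mat n n \<and> (\<exists>N \<in> carrier_mat n n. N * M = 1\<^sub>m n \<and> M * N = 1\<^sub>m n)"
  by (auto simp: GL_def units_of_def Units_def ring_mat_simps)

lemma GL_simps: "mult (GL n) = (*)" "one (GL n) = 1\<^sub>m n"
  by (auto simp: GL_def units_of_def ring_mat_simps)

lemma AGL_simps: "mult (AGL n) = (*)" "one (AGL n) = 1\<^sub>m (n + 1)"
  by (auto simp: AGL_def GL_simps)

lemma carrier_AGL:
  "M \<in> carrier (AGL n) \<longleftrightarrow> M \<in> carrier (GL (n + 1)) \<and> col M 0 = unit_vec (n + 1) 0"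
  by (simp add: AGL_def)

lemma group_GL: "group (GL n)"
proof -
  interpret semiring "ring_mat TYPE('a) n ()" by (rule semiring_mat)
  show ?thesis unfolding GL_def by (rule units_group)
qed

lemma mult_unit_vec_0:
  fixes M :: "'a::field mat"
  assumes "M \<in> carrier_mat (Suc n) (Suc n)"
  shows "M *\<^sub>v unit_vec (Suc n) 0 = col M 0"
  using assms by (intro eq_vecI) auto

text \<open>By \<open>mult_unit_vec_0\<close> the condition on the first column says that the matrix
  fixes the first unit column vector. The group is therefore a stabiliser, closed under products and
  inverses.\<close>

lemma group_AGL: "group (AGL n :: 'a::field mat monoid)"
proof -
  interpret GL: group "GL (Suc n) :: 'a mat monoid" by (rule group_GL)
  let ?H = "{M \<in> carrier (GL (Suc n)). col M 0 = unit_vec (Suc n) (0::nat)} :: 'a mat set"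
  have "subgroup ?H (GL (Suc n))"
  proof (rule GL.subgroupI)
    have "(1\<^sub>m (Suc n) :: 'a mat) \<in> ?H"
      using GL.one_closed by (simp add: GL_simps)
    then show "?H \<noteq> {}" by blast
  next
    fix M assume M: "M \<in> ?H"
    let ?N = "inv\<^bsub>GL (Suc n)\<^esub> M"
    have N: "?N \<in> carrier (GL (Suc n))" using M by simp
    have c: "M \<in> carrier_mat (Suc n) (Suc n)" "?N \<in> carrier_mat (Suc n) (Suc n)"
      using M N by (auto simp: carrier_GL)
    have NM: "?N * M = 1\<^sub>m (Suc n)" using GL.l_inv[of M] M by (simp add: GL_simps)
    have "col ?N 0 = ?N *\<^sub>v (M *\<^sub>v unit_vec (Suc n) 0)"
      using M mult_unit_vec_0[OF c(1)] mult_unit_vec_0[OF c(2)] by simp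
    also have "\<dots> = (?N * M) *\<^sub>v unit_vec (Suc n) 0"
      using c by (intro assoc_mult_mat_vec[symmetric]) auto
    also have "\<dots> = unit_vec (Suc n) 0" using NM by simp
    finally show "?N \<in> ?H" using N by simp
  next
    fix M N assume M: "M \<in> ?H" and N: "N \<in> ?H"
    then have c: "M \<in> carrier_mat (Suc n) (Suc n)" "N \<in> carrier_mat (Suc n) (Suc n)"
      by (auto simp: carrier_GL)
    have MN: "M * N \<in> carrier (GL (Suc n))" using GL.m_closed M N by (simp add: GL_simps)
    have "col (M * N) 0 = (M * N) *\<^sub>v unit_vec (Suc n) 0"
      using c by (intro mult_unit_vec_0[symmetric]) auto
    also have "\<dots> = M *\<^sub>v (N *\<^sub>v unit_vec (Suc n) 0)"
      using c by (intro assoc_mult_mat_vec) auto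
    also have "\<dots> = unit_vec (Suc n) 0" using M N c by (simp add: mult_unit_vec_0)
    finally show "M \<otimes>\<^bsub>GL (Suc n)\<^esub> N \<in> ?H" using MN by (simp add: GL_simps)
  qed auto
  then have "group ((GL (Suc n)) \<lparr> carrier := ?H \<rparr>)" by (rule GL.subgroup_imp_group)
  then show ?thesis by (simp add: AGL_def)
qed

section \<open>Four by four matrices and the unipotent family\<close>

lemma less_4_cases: "(i::nat) < 4 \<longleftrightarrow> i = 0 \<or> i = 1 \<or> i = 2 \<or> i = 3"
  by auto

lemma mat4_eqI:
  assumes "M \<in> carrier_mat 4 4" "N \<in> carrier_mat 4 4"
    and "\<And>i j. i \<in> {0,1,2,3} \<Longrightarrow> j \<in> {0,1,2,3} \<Longrightarrow> M $$ (i, j) = N $$ (i, j)"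
  shows "M = N"
  using assms by (intro eq_matI) (auto simp: less_4_cases)

lemma mat4_mult_index:
  assumes "M \<in> carrier_mat 4 4" "N \<in> carrier_mat 4 4" "i < 4" "j < 4"
  shows "(M * N) $$ (i, j) =
    M $$ (i, 0) * N $$ (0, j) + M $$ (i, 1) * N $$ (1, j) + M $$ (i, 2) * N $$ (2, j) + M $$ (i, 3) * N $$ (3, j)"
proof -
  have "{0..<4} = {0, 1, 2, 3::nat}" by auto
  then show ?thesis using assms by (simp add: scalar_prod_def add_ac)
qed

lemma mat4_of_rows_index:
  assumes "length xs = 4"
  shows "mat_of_rows_list 4 xs \<in> carrier_mat 4 4"
    "i < 4 \<Longrightarrow> j < 4 \<Longrightarrow> mat_of_rows_list 4 xs $$ (i, j) = xs ! i ! j"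
  using assms by (auto simp: mat_of_rows_list_def)

text \<open>The free diagonal value \<open>c\<close> covers three situations at once: group elements
  for \<open>c = 1\<close>, their differences from the identity for \<open>c = 0\<close>, and
  arbitrary elements of the algebra generated with the scalars.\<close>

definition ut :: "'a::field \<Rightarrow> 'a \<Rightarrow> 'a \<Rightarrow> 'a \<Rightarrow> 'a \<Rightarrow> 'a \<Rightarrow> 'a \<Rightarrow> 'a mat" where
  "ut c x y z p q r = mat_of_rows_list 4
     [[c, x, y, z],
      [0, c, p, q],
      [0, 0, c, r],
      [0, 0, 0, c]]"

lemma ut_carrier [simp]: "ut c x y z p q r \<in> carrier_mat 4 4"
  by (simp add: ut_def mat4_of_rows_index)

lemma ut_dim [simp]: "dim_row (ut c x y z p q r) = 4" "dim_col (ut c x y z p q r) = 4"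
  using ut_carrier by blast+

lemma ut_index [simp]:
  "ut c x y z p q r $$ (0, 0) = c" "ut c x y z p q r $$ (0, Suc 0) = x"
  "ut c x y z p q r $$ (0, 2) = y" "ut c x y z p q r $$ (0, 3) = z"
  "ut c x y z p q r $$ (Suc 0, 0) = 0" "ut c x y z p q r $$ (Suc 0, Suc 0) = c"
  "ut c x y z p q r $$ (Suc 0, 2) = p" "ut c x y z p q r $$ (Suc 0, 3) = q"
  "ut c x y z p q r $$ (2, 0) = 0" "ut c x y z p q r $$ (2, Suc 0) = 0"
  "ut c x y z p q r $$ (2, 2) = c" "ut c x y z p q r $$ (2, 3) = r"
  "ut c x y z p q r $$ (3, 0) = 0" "ut c x y z p q r $$ (3, Suc 0) = 0"
  "ut c x y z p q r $$ (3, 2) = 0" "ut c x y z p q r $$ (3, 3) = c"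
  by (simp_all add: ut_def mat4_of_rows_index)

lemma ut_eq_iff [simp]:
  "ut c x y z p q r = ut c' x' y' z' p' q' r' \<longleftrightarrow>
     c = c' \<and> x = x' \<and> y = y' \<and> z = z' \<and> p = p' \<and> q = q' \<and> r = r'"
  by (metis ut_index(1-4,7,8,12))

lemma ut_mult:
  "ut c x y z p q r * ut c' x' y' z' p' q' r' =
     ut (c * c') (c * x' + x * c') (c * y' + x * p' + y * c') (c * z' + x * q' + y * r' + z * c')
       (c * p' + p * c') (c * q' + p * r' + q * c') (c * r' + r * c')"
  by (rule mat4_eqI) (auto simp: mat4_mult_index simp del: index_mult_mat(1))

lemma ut_add:
  "ut c x y z p q r + ut c' x' y' z' p' q' r' =
     ut (c + c') (x + x') (y + y') (z + z') (p + p') (q + q') (r + r')"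
  by (rule mat4_eqI) auto

lemma ut_minus:
  "ut c x y z p q r - ut c' x' y' z' p' q' r' =
     ut (c - c') (x - x') (y - y') (z - z') (p - p') (q - q') (r - r')"
  by (rule mat4_eqI) (auto intro: minus_carrier_mat)

lemma ut_smult:
  "k \<cdot>\<^sub>m ut c x y z p q r = ut (k * c) (k * x) (k * y) (k * z) (k * p) (k * q) (k * r)"
  by (rule mat4_eqI) auto

lemma ut_one: "1\<^sub>m 4 = ut 1 0 0 0 0 0 0"
  by (rule mat4_eqI) auto

lemma ut_zero: "0\<^sub>m 4 4 = ut 0 0 0 0 0 0 0"
  by (rule mat4_eqI) auto

text \<open>The matrix \<open>elem a p q r c x y z\<close> is the right regular representation of
  \<open>c + x e\<^sub>1 + y e\<^sub>2 + z e\<^sub>3\<close>, where \<open>e\<^sub>1\<^sup>2 = a e\<^sub>2 + p e\<^sub>3\<close>, \<open>e\<^sub>1 e\<^sub>2 = q e\<^sub>3\<close>, \<open>e\<^sub>2\<^sup>2 = r e\<^sub>3\<close>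
  and \<open>e\<^sub>3\<close> annihilates every \<open>e\<^sub>i\<close>; associativity forces \<open>a r = 0\<close>.\<close>

definition elem :: "'a::field \<Rightarrow> 'a \<Rightarrow> 'a \<Rightarrow> 'a \<Rightarrow> 'a \<Rightarrow> 'a \<Rightarrow> 'a \<Rightarrow> 'a \<Rightarrow> 'a mat" where
  "elem a p q r c x y z = ut c x y z (a * x) (p * x + q * y) (q * x + r * y)"

definition fam :: "'a::field \<Rightarrow> 'a \<Rightarrow> 'a \<Rightarrow> 'a \<Rightarrow> 'a mat set" where
  "fam a p q r = {elem a p q r 1 x y z | x y z. True}"

lemma fam_instances:
  "S_4 = fam 1 0 1 0" "S_31 = fam 1 0 0 0" "R_sub l = fam 0 1 0 l" "U_13 = fam 0 0 1 0"
  "S_211 = fam 0 0 0 0"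
  by (simp_all add: S_4_def S_31_def R_sub_def U_13_def S_211_def fam_def elem_def ut_def)

text \<open>Closure is at stake in two entries: entry (1,3) of the product contains
  \<open>a * r * x * y'\<close>, and the shape of \<open>elem\<close> demands
  \<open>r * a * x * x'\<close> in entry (2,3). The hypothesis removes both.\<close>

lemma elem_mult:
  assumes "a * r = 0"
  shows "elem a p q r c x y z * elem a p q r c' x' y' z' =
    elem a p q r (c * c') (c * x' + x * c') (c * y' + y * c' + a * x * x')
      (c * z' + z * c' + p * x * x' + q * (x * y' + y * x') + r * y * y')"
proof -
  have "a * (r * t) = 0" "r * (a * t) = 0" for t
    using assms by (auto simp: mult.commute)
  then show ?thesis
    by (simp add: elem_def ut_mult algebra_simps) (metis assms mult_zero_left mult.commute mult.assoc)
qed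

lemma elem_add:
  "elem a p q r c x y z + elem a p q r c' x' y' z' = elem a p q r (c + c') (x + x') (y + y') (z + z')"
  by (simp add: elem_def ut_add algebra_simps)

lemma elem_smult: "k \<cdot>\<^sub>m elem a p q r c x y z = elem a p q r (k * c) (k * x) (k * y) (k * z)"
  by (simp add: elem_def ut_smult algebra_simps)

lemma elem_one: "1\<^sub>m 4 = elem a p q r 1 0 0 0"
  by (simp add: elem_def ut_one)

lemma elem_zero: "0\<^sub>m 4 4 = elem a p q r 0 0 0 0"
  by (simp add: elem_def ut_zero)

lemma elem_eq_iff [simp]:
  "elem a p q r c x y z = elem a p q r c' x' y' z' \<longleftrightarrow> c = c' \<and> x = x' \<and> y = y' \<and> z = z'"
  by (auto simp: elem_def)

lemma elem_carrier [simp]: "elem a p q r c x y z \<in> carrier_mat 4 4"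
  by (simp add: elem_def)

lemma elem_dim [simp]:
  "dim_row (elem a p q r c x y z) = 4" "dim_col (elem a p q r c x y z) = 4"
  by (simp_all add: elem_def)

lemma elem_inverse:
  assumes "a * r = 0"
  shows "\<exists>x' y' z'. elem a p q r 1 x y z * elem a p q r 1 x' y' z' = 1\<^sub>m 4"
proof -
  \<comment> \<open>By \<open>elem_mult\<close> the equations for the inverse are triangular: the
    first gives \<open>- x\<close>, the second then gives the third parameter, and the last one is
    solved for the remaining coordinate.\<close>
  have "elem a p q r 1 x y z * elem a p q r 1 (- x) (a * x * x - y)
      (p * x * x - q * (x * (a * x * x - y) - y * x) - r * y * (a * x * x - y) - z) = 1\<^sub>m 4"
    unfolding elem_mult[OF assms] elem_one[of a p q r] by (simp add: algebra_simps)
  then show ?thesis by blast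
qed

lemma fam_commute:
  assumes "a * r = 0" "M \<in> fam a p q r" "N \<in> fam a p q r"
  shows "M * N = N * M"
  using assms(2,3) unfolding fam_def by (auto simp: elem_mult[OF assms(1)] algebra_simps)

lemma fam_subset_AGL:
  assumes "a * r = 0"
  shows "fam a p q r \<subseteq> carrier (AGL 3)"
proof
  fix M assume "M \<in> fam a p q r"
  then obtain x y z where M: "M = elem a p q r 1 x y z" unfolding fam_def by blast
  obtain x' y' z' where inv: "elem a p q r 1 x y z * elem a p q r 1 x' y' z' = 1\<^sub>m 4"
    using elem_inverse[OF assms] by blast
  then have "elem a p q r 1 x' y' z' * elem a p q r 1 x y z = 1\<^sub>m 4"
    unfolding elem_mult[OF assms] by (simp add: algebra_simps)
  with inv have "M \<in> carrier (GL 4)" unfolding carrier_GL M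
    by (intro conjI bexI[of _ "elem a p q r 1 x' y' z'"]) auto
  moreover have "col M 0 = unit_vec 4 0" unfolding M elem_def
    by (intro eq_vecI) (auto simp: less_4_cases)
  ultimately show "M \<in> carrier (AGL 3)" by (simp add: carrier_AGL)
qed

lemma row_0_eq_vCons_iff:
  assumes "M \<in> carrier_mat 4 4" "v \<in> carrier_vec 3"
  shows "row M 0 = vCons 1 v \<longleftrightarrow>
    M $$ (0, 0) = 1 \<and> M $$ (0, 1) = v $ 0 \<and> M $$ (0, 2) = v $ 1 \<and> M $$ (0, 3) = v $ 2"
proof -
  have "row M 0 = vCons 1 v \<longleftrightarrow> (\<forall>i<4. M $$ (0, i) = vCons 1 v $ i)"
    using assms by (auto simp: vec_eq_iff)
  also have "\<dots> \<longleftrightarrow> (\<forall>i \<in> {0, Suc 0, Suc 1, Suc 2}. M $$ (0, i) = vCons 1 v $ i)"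
    by (auto simp: less_4_cases numeral_3_eq_3 numeral_2_eq_2)
  finally show ?thesis by (simp add: numeral_3_eq_3 numeral_2_eq_2)
qed

lemma fam_abelian_regular:
  assumes "a * r = 0"
  shows "fam a p q r \<in> abelian_regular_subgroups 3"
proof -
  interpret AGL: group "AGL 3 :: 'a mat monoid" by (rule group_AGL)
  have sg: "subgroup (fam a p q r) (AGL 3)"
  proof (rule AGL.subgroupI[OF fam_subset_AGL[OF assms]])
    show "fam a p q r \<noteq> {}" unfolding fam_def by blast
  next
    fix M assume M: "M \<in> fam a p q r"
    then obtain x y z where "M = elem a p q r 1 x y z" unfolding fam_def by blast
    then obtain N where N: "N \<in> fam a p q r" "M * N = 1\<^sub>m 4"
      using elem_inverse[OF assms] unfolding fam_def by blast
    have "inv\<^bsub>AGL 3\<^esub> M = N"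
      using M N fam_subset_AGL[OF assms] fam_commute[OF assms, of M p q N]
      by (intro AGL.inv_equality) (auto simp: AGL_simps)
    with N show "inv\<^bsub>AGL 3\<^esub> M \<in> fam a p q r" by simp
  next
    fix M N assume "M \<in> fam a p q r" "N \<in> fam a p q r"
    then show "M \<otimes>\<^bsub>AGL 3\<^esub> N \<in> fam a p q r"
      unfolding fam_def AGL_simps by (auto simp: elem_mult[OF assms])
  qed
  have cg: "comm_group ((AGL 3) \<lparr> carrier := fam a p q r \<rparr>)"
    by (rule group.group_comm_groupI[OF AGL.subgroup_imp_group[OF sg]])
      (use fam_commute[OF assms] in \<open>simp add: AGL_simps\<close>)
  have "regular_subset 3 (fam a p q r)" unfolding regular_subset_def
  proof
    fix v :: "'a vec" assume v: "v \<in> carrier_vec 3"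
    show "\<exists>!M. M \<in> fam a p q r \<and> row M 0 = vCons 1 v"
    proof (rule ex1I[of _ "elem a p q r 1 (v $ 0) (v $ 1) (v $ 2)"])
      show "elem a p q r 1 (v $ 0) (v $ 1) (v $ 2) \<in> fam a p q r \<and>
          row (elem a p q r 1 (v $ 0) (v $ 1) (v $ 2)) 0 = vCons 1 v"
        unfolding row_0_eq_vCons_iff[OF elem_carrier v] by (auto simp: fam_def elem_def)
    next
      fix M assume "M \<in> fam a p q r \<and> row M 0 = vCons 1 v"
      then obtain x y z where M: "M = elem a p q r 1 x y z" "row M 0 = vCons 1 v"
        unfolding fam_def by blast
      then show "M = elem a p q r 1 (v $ 0) (v $ 1) (v $ 2)"
        using row_0_eq_vCons_iff[OF elem_carrier v, of a p q r 1 x y z] by (simp add: elem_def)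
    qed
  qed
  with sg cg show ?thesis unfolding abelian_regular_subgroups_def by blast
qed

section \<open>The algebra of an abelian regular subgroup\<close>

text \<open>Triples form a whole type with addition, as the vector space locale requires, whereas
  \<open>carrier_vec 3\<close> is only a subset of a type.\<close>

definition scale3 :: "'a::field \<Rightarrow> 'a \<times> 'a \<times> 'a \<Rightarrow> 'a \<times> 'a \<times> 'a" where
  "scale3 c v = (case v of (x, y, z) \<Rightarrow> (c * x, c * y, c * z))"

lemma scale3_simp [simp]: "scale3 c (x, y, z) = (c * x, c * y, c * z)"
  by (simp add: scale3_def)

definition basis3 :: "('a::field \<times> 'a \<times> 'a) set" where
  "basis3 = {(1, 0, 0), (0, 1, 0), (0, 0, 1)}"

interpretation vec3: finite_dimensional_vector_space scale3 basis3
proof -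
  interpret vector_space scale3
    by unfold_locales (auto simp: scale3_def algebra_simps split: prod.splits)
  show "finite_dimensional_vector_space scale3 (basis3 :: ('a \<times> 'a \<times> 'a) set)"
  proof
    show "finite (basis3 :: ('a \<times> 'a \<times> 'a) set)" by (simp add: basis3_def)
    show "independent (basis3 :: ('a \<times> 'a \<times> 'a) set)"
      by (rule independent_if_scalars_zero) (auto simp: basis3_def zero_prod_def)
    show "span (basis3 :: ('a \<times> 'a \<times> 'a) set) = UNIV"
    proof (intro subset_antisym subsetI)
      fix v :: "'a \<times> 'a \<times> 'a"
      obtain x y z where v: "v = (x, y, z)" by (cases v) auto
      have "scale3 x (1, 0, 0) + scale3 y (0, 1, 0) + scale3 z (0, 0, 1) \<in> span basis3"
        by (intro span_add span_scale span_base) (auto simp: basis3_def)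
      then show "v \<in> span basis3" by (simp add: v)
    qed simp
  qed
qed

lemma card_basis3: "card (basis3 :: ('a::field \<times> 'a \<times> 'a) set) = 3"
  by (simp add: basis3_def)

definition top_row :: "'a::field mat \<Rightarrow> 'a \<times> 'a \<times> 'a" where
  "top_row M = (M $$ (0, 1), M $$ (0, 2), M $$ (0, 3))"

text \<open>This is the row vector \<open>v\<close> times the linear part of \<open>M\<close>, with
  the indices of the full matrix kept.\<close>

definition act :: "'a::field \<times> 'a \<times> 'a \<Rightarrow> 'a mat \<Rightarrow> 'a \<times> 'a \<times> 'a" where
  "act v M = (case v of (x, y, z) \<Rightarrow>
     (x * M $$ (1, 1) + y * M $$ (2, 1) + z * M $$ (3, 1),
      x * M $$ (1, 2) + y * M $$ (2, 2) + z * M $$ (3, 2),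
      x * M $$ (1, 3) + y * M $$ (2, 3) + z * M $$ (3, 3)))"

lemma act_add: "act (v + w) M = act v M + act w M"
  by (cases v; cases w) (simp add: act_def algebra_simps)

lemma act_scale: "act (scale3 c v) M = scale3 c (act v M)"
  by (cases v) (simp add: act_def algebra_simps)

lemma act_one: "act v (1\<^sub>m 4) = v"
  by (cases v) (simp add: act_def)

lemma top_row_one: "top_row (1\<^sub>m 4) = 0"
  by (simp add: top_row_def zero_prod_def)

definition affine4 :: "'a::field mat \<Rightarrow> bool" where
  "affine4 M \<longleftrightarrow> M \<in> carrier_mat 4 4 \<and> M $$ (0, 0) = 1 \<and> M $$ (1, 0) = 0 \<and> M $$ (2, 0) = 0 \<and> M $$ (3, 0) = 0"

lemma carrier_AGL_3:
  "M \<in> carrier (AGL 3) \<longleftrightarrow>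
     affine4 M \<and> (\<exists>N \<in> carrier_mat 4 4. N * M = 1\<^sub>m 4 \<and> M * N = 1\<^sub>m 4)"
proof -
  have "col M 0 = unit_vec 4 0 \<longleftrightarrow> M $$ (0, 0) = 1 \<and> M $$ (1, 0) = 0 \<and> M $$ (2, 0) = 0 \<and> M $$ (3, 0) = 0"
    if "M \<in> carrier_mat 4 4"
    using that by (auto simp: vec_eq_iff less_4_cases)
  then show ?thesis
    unfolding carrier_AGL carrier_GL affine4_def by auto
qed

text \<open>The semidirect product law: blocks \<open>(v, A)\<close> and \<open>(w, B)\<close>
  multiply to \<open>(w + v B, A B)\<close>.\<close>

lemma affine4_mult:
  assumes "affine4 M" "affine4 N"
  shows "top_row (M * N) = top_row N + act (top_row M) N"
    and "act (act v M) N = act v (M * N)"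
  using assms
  by (cases v; simp add: affine4_def top_row_def act_def mat4_mult_index algebra_simps del: index_mult_mat(1))+

text \<open>Turns matrix identities into identities between triples, where the algebra product can
  be used.\<close>

lemma affine4_eq_iff:
  assumes "affine4 M" "affine4 N"
  shows "M = N \<longleftrightarrow> top_row M = top_row N \<and> (\<forall>v \<in> basis3. act v M = act v N)"
proof (intro iffI mat4_eqI)
  assume "top_row M = top_row N \<and> (\<forall>v \<in> basis3. act v M = act v N)"
  then show "M $$ (i, j) = N $$ (i, j)" if "i \<in> {0, 1, 2, 3}" "j \<in> {0, 1, 2, 3}" for i j
    using that assms by (auto simp: affine4_def basis3_def act_def top_row_def)
qed (use assms in \<open>auto simp: affine4_def\<close>)

section \<open>The product on triples defined by an abelian regular subgroup\<close>

locale abelian_regular_3 =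
  fixes R :: "'a::field mat set"
  assumes abelian_regular: "R \<in> abelian_regular_subgroups 3"
begin

lemma R_subgroup: "subgroup R (AGL 3)"
  using abelian_regular by (simp add: abelian_regular_subgroups_def)

lemma R_subset: "R \<subseteq> carrier (AGL 3)"
  using R_subgroup by (rule subgroup.subset)

lemma R_affine4: "M \<in> R \<Longrightarrow> affine4 M"
  using R_subset carrier_AGL_3 by blast

lemma R_mult: "M \<in> R \<Longrightarrow> N \<in> R \<Longrightarrow> M * N \<in> R"
  using subgroup.m_closed[OF R_subgroup] by (simp add: AGL_simps)

lemma R_commute:
  assumes "M \<in> R" "N \<in> R"
  shows "M * N = N * M"
proof -
  interpret comm_group "(AGL 3) \<lparr> carrier := R \<rparr>"
    using abelian_regular by (simp add: abelian_regular_subgroups_def)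
  show ?thesis using m_comm[of M N] assms by (simp add: AGL_simps)
qed

lemma R_inverse:
  assumes "M \<in> R"
  shows "\<exists>N \<in> R. M * N = 1\<^sub>m 4"
proof -
  interpret AGL: group "AGL 3 :: 'a mat monoid" by (rule group_AGL)
  have "M \<otimes>\<^bsub>AGL 3\<^esub> inv\<^bsub>AGL 3\<^esub> M = \<one>\<^bsub>AGL 3\<^esub>" using assms R_subset by auto
  then show ?thesis using subgroup.m_inv_closed[OF R_subgroup assms] by (auto simp: AGL_simps)
qed

lemma R_regular: "\<exists>!M. M \<in> R \<and> top_row M = t"
proof -
  obtain x y z where t: "t = (x, y, z)" by (cases t) auto
  let ?v = "vec 3 (\<lambda>i. [x, y, z] ! i)"
  have v: "?v \<in> carrier_vec 3" by simp
  have nth: "?v $ 0 = x" "?v $ 1 = y" "?v $ 2 = z" by simp_all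
  have "M \<in> R \<and> row M 0 = vCons 1 ?v \<longleftrightarrow> M \<in> R \<and> top_row M = t" for M
    using row_0_eq_vCons_iff[OF _ v, of M] R_affine4[of M]
    unfolding nth affine4_def by (auto simp: t top_row_def)
  moreover have "\<exists>!M. M \<in> R \<and> row M 0 = vCons 1 ?v"
    using abelian_regular v by (auto simp: abelian_regular_subgroups_def regular_subset_def)
  ultimately show ?thesis by simp
qed

definition elt :: "'a \<times> 'a \<times> 'a \<Rightarrow> 'a mat" where
  "elt t = (THE M. M \<in> R \<and> top_row M = t)"

lemma elt: "elt t \<in> R" "top_row (elt t) = t"
  using theI'[OF R_regular[of t]] by (auto simp: elt_def)

lemma elt_top_row: "M \<in> R \<Longrightarrow> elt (top_row M) = M"
  using R_regular[of "top_row M"] elt by blast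

definition mul :: "'a \<times> 'a \<times> 'a \<Rightarrow> 'a \<times> 'a \<times> 'a \<Rightarrow> 'a \<times> 'a \<times> 'a" where
  "mul v w = act v (elt w) - v"

lemma act_elt: "act v (elt w) = v + mul v w"
  by (simp add: mul_def)

text \<open>Both sides have the same first row, and by regularity this determines the element. The
  group law is thus the circle operation of the algebra.\<close>

lemma elt_mult: "elt v * elt w = elt (w + v + mul v w)"
proof -
  have "top_row (elt v * elt w) = w + v + mul v w"
    using affine4_mult(1)[of "elt v" "elt w"] by (simp add: R_affine4 elt act_elt add.assoc)
  then show ?thesis using elt_top_row R_mult elt(1) by metis
qed

lemma mul_commute: "mul v w = mul w v"
proof -
  have "elt (w + v + mul v w) = elt (v + w + mul w v)"
    using R_commute[of "elt v" "elt w"] by (simp add: elt elt_mult)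
  then have "w + v + mul v w = v + w + mul w v" by (metis elt(2))
  then show ?thesis by (simp add: add.commute)
qed

lemma mul_add: "mul (u + v) w = mul u w + mul v w"
  by (simp add: mul_def act_add)

lemma mul_scale: "mul (scale3 c v) w = scale3 c (mul v w)"
  by (simp add: mul_def act_scale vec3.scale_right_diff_distrib)

lemma act_act: "act (act u (elt v)) (elt w) = act u (elt (w + v + mul v w))"
  using affine4_mult(2)[of "elt v" "elt w"] by (simp add: R_affine4 elt elt_mult)

text \<open>Expanding \<open>act_act\<close> on both sides leaves exactly this identity. Additivity
  in the second argument is obtained from the first through commutativity.\<close>

lemma mul_associative: "mul (mul u v) w = mul u (mul v w)"
proof -
  have "mul (mul u v) w + mul u w = mul u (w + v + mul v w) - mul u v"
    using act_act[of u v w] by (simp add: act_elt mul_add algebra_simps)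
  also have "\<dots> = mul u w + mul u (mul v w)"
    by (simp add: mul_commute[of u "w + v + mul v w"] mul_add)
      (simp add: mul_commute[of _ u])
  finally show ?thesis by (simp add: add.commute)
qed

text \<open>If \<open>mul v w = v\<close>, then \<open>mul v (- w) = - v\<close>, so the element
  belonging to \<open>- w\<close> sends \<open>v\<close> to 0. That element is invertible within the
  group.\<close>

lemma mul_fixed_imp_0:
  assumes "mul v w = v"
  shows "v = 0"
proof -
  have "mul v (- w) = - v"
    using mul_scale[of "-1" w v] assms by (simp add: mul_commute[of v])
  then have "act v (elt (- w)) = 0" by (simp add: act_elt)
  moreover obtain N where "N \<in> R" "elt (- w) * N = 1\<^sub>m 4"
    using R_inverse elt(1) by blast
  ultimately have "act 0 N = v"
    using affine4_mult(2)[of "elt (- w)" N v] by (simp add: R_affine4 elt act_one)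
  moreover have "act 0 N = 0" using act_scale[of 0 0 N] by simp
  ultimately show ?thesis by simp
qed

sublocale quasi_regular_algebra scale3 basis3 mul
  by unfold_locales
    (fact mul_commute mul_associative mul_add mul_scale mul_fixed_imp_0 card_basis3)+

text \<open>Writing the basis \<open>u\<^sub>1, u\<^sub>2, u\<^sub>3\<close> into the rows of \<open>g\<close> gives \<open>g M\<^sub>v = M'\<^sub>x g\<close> whenever
  \<open>v = x\<^sub>1 u\<^sub>1 + x\<^sub>2 u\<^sub>2 + x\<^sub>3 u\<^sub>3\<close>.\<close>

lemma table_imp_conj_fam:
  assumes table: "table u1 u2 u3 a p q r" and ar: "a * r = 0"
  shows "conj_in (AGL 3) R (fam a p q r)"
proof -
  interpret AGL: group "AGL 3 :: 'a mat monoid" by (rule group_AGL)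
  have free: "free3 u1 u2 u3" using table by (simp add: table_def)
  define mk where "mk s t w = (case (s, t, w) of ((a1, b1, c1), (a2, b2, c2), (a3, b3, c3)) \<Rightarrow>
    mat_of_rows_list 4 [[1, 0, 0, 0], [0, a1, b1, c1], [0, a2, b2, c2], [0, a3, b3, c3::'a]])" for s t w
  have mk: "affine4 (mk s t w)" "top_row (mk s t w) = 0"
    "act (x, y, z) (mk s t w) = scale3 x s + scale3 y t + scale3 z w" for s t w x y z
    by (cases s; cases t; cases w;
        simp add: mk_def affine4_def top_row_def act_def mat4_of_rows_index zero_prod_def)+
  define g where "g = mk u1 u2 u3"
  note g = mk[where s = u1 and t = u2 and w = u3, folded g_def]
  have "\<exists>w. act w g = v" for v
    using free3_spans[OF free, of v] g(3) by metis
  \<comment> \<open>The preimages of the unit vectors are the rows of the inverse of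
    \<open>g\<close>; they exist because the triple spans.\<close>
  then obtain w1 w2 w3 where w: "act w1 g = (1, 0, 0)" "act w2 g = (0, 1, 0)" "act w3 g = (0, 0, 1)"
    by metis
  define h where "h = mk w1 w2 w3"
  note h = mk[where s = w1 and t = w2 and w = w3, folded h_def]
  have c: "g \<in> carrier_mat 4 4" "h \<in> carrier_mat 4 4" using g h by (auto simp: affine4_def)
  have aff_mult: "affine4 (M * N)" if "affine4 M" "affine4 N" for M N :: "'a mat"
    using that mult_carrier_mat[of M 4 4 N 4]
    by (simp add: affine4_def mat4_mult_index del: index_mult_mat(1))
  have one: "affine4 (1\<^sub>m 4)" by (simp add: affine4_def)
  have act0: "act 0 M = 0" for M using act_scale[of 0 0 M] by simp
  have hg: "h * g = 1\<^sub>m 4"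
    unfolding affine4_eq_iff[OF aff_mult[OF h(1) g(1)] one]
    using w by (simp add: affine4_mult g h act0 top_row_one act_one basis3_def flip: affine4_mult(2))
  then have gh: "g * h = 1\<^sub>m 4" using mat_mult_left_right_inverse[OF c(2,1)] by simp
  have gA: "g \<in> carrier (AGL 3)"
    unfolding carrier_AGL_3 using g(1) c hg gh by blast
  have "g * elt v = elem a p q r 1 x y z * g"
    if v: "v = scale3 x u1 + scale3 y u2 + scale3 z u3" for v x y z
  proof -
    have e: "affine4 (elt v)" "affine4 (elem a p q r 1 x y z)"
      by (simp_all add: R_affine4 elt) (simp add: affine4_def elem_def)
    have tope: "top_row (elem a p q r 1 x y z) = (x, y, z)"
      by (simp add: top_row_def elem_def)
    have acte: "act (1, 0, 0) (elem a p q r 1 x y z) = (1, a * x, p * x + q * y)"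
      "act (0, 1, 0) (elem a p q r 1 x y z) = (0, 1, q * x + r * y)"
      "act (0, 0, 1) (elem a p q r 1 x y z) = (0, 0, 1)"
      by (simp_all add: act_def elem_def)
    have m: "mul u1 u1 = scale3 a u2 + scale3 p u3" "mul u1 u2 = scale3 q u3"
      "mul u2 u1 = scale3 q u3" "mul u2 u2 = scale3 r u3"
      "mul u3 u1 = 0" "mul u3 u2 = 0" "mul u3 u3 = 0" "mul u1 u3 = 0" "mul u2 u3 = 0"
      using table unfolding table_def by (simp_all add: mul_comm)
    \<comment> \<open>Both sides have top row \<open>v\<close>, and both send the i-th unit vector
      to \<open>u_i + mul u_i v\<close>: directly on the left, through the multiplication table on
      the right.\<close>
    show ?thesis
      unfolding affine4_eq_iff[OF aff_mult[OF g(1) e(1)] aff_mult[OF e(2) g(1)]]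
      using g e
      by (auto simp: affine4_mult g e elt act0 tope v acte basis3_def act_elt mul_linear m algebra_simps
          simp flip: affine4_mult(2))
  qed
  then have key: "v = scale3 x u1 + scale3 y u2 + scale3 z u3 \<Longrightarrow> g * elt v = elem a p q r 1 x y z * g"
    for v x y z .
  show ?thesis
    unfolding AGL.conj_in_iff[OF R_subset fam_subset_AGL[OF ar]] AGL_simps
  proof (rule bexI[OF _ gA], intro conjI ballI)
    fix M assume M: "M \<in> R"
    obtain x y z where "top_row M = scale3 x u1 + scale3 y u2 + scale3 z u3"
      using free3_spans[OF free] by blast
    with key[of "top_row M"] elt_top_row[OF M] show "\<exists>k \<in> fam a p q r. g * M = k * g"
      unfolding fam_def by auto
  next
    fix k assume "k \<in> fam a p q r"
    then obtain x y z where "k = elem a p q r 1 x y z" unfolding fam_def by blast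
    with key[OF refl, of x y z] elt(1) show "\<exists>h \<in> R. g * h = k * g" by blast
  qed
qed

end

section \<open>Indecomposability and non-conjugacy\<close>

lemma row_vec_mult_lin_part_elem:
  assumes "w \<in> carrier_vec 3"
  shows "row_vec_mult w (lin_part (elem a p q r c x y z)) =
    vec 3 (\<lambda>j. [c * w $ 0, a * x * w $ 0 + c * w $ 1,
      (p * x + q * y) * w $ 0 + (q * x + r * y) * w $ 1 + c * w $ 2] ! j)"
proof (rule eq_vecI)
  fix j :: nat
  assume "j < dim_vec (vec 3 (\<lambda>j. [c * w $ 0, a * x * w $ 0 + c * w $ 1,
      (p * x + q * y) * w $ 0 + (q * x + r * y) * w $ 1 + c * w $ 2] ! j))"
  then have j: "j = 0 \<or> j = 1 \<or> j = 2" by auto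
  have r: "{0..<3} = {0, 1, 2::nat}" by auto
  show "row_vec_mult w (lin_part (elem a p q r c x y z)) $ j =
    vec 3 (\<lambda>j. [c * w $ 0, a * x * w $ 0 + c * w $ 1,
      (p * x + q * y) * w $ 0 + (q * x + r * y) * w $ 1 + c * w $ 2] ! j) $ j"
    using j assms
    by (auto simp: row_vec_mult_def lin_part_def mat_delete_def elem_def scalar_prod_def r
        eval_nat_numeral(2) ut_index[unfolded numeral_2_eq_2 numeral_3_eq_3] numeral_3_eq_3 algebra_simps)
qed (simp add: row_vec_mult_def lin_part_def)

text \<open>Every nonzero invariant subspace contains the last unit vector, so no two of them meet
  trivially. The hypothesis supplies, for a vector off the last axis, a group element that moves it
  by a nonzero multiple of that unit vector.\<close>

lemma fam_indecomposable:
  assumes hit: "\<And>v0 v1. v0 \<noteq> 0 \<or> v1 \<noteq> 0 \<Longrightarrow>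
      \<exists>x y. a * x * v0 = 0 \<and> (p * x + q * y) * v0 + (q * x + r * y) * v1 \<noteq> 0"
  shows "indecomposable 3 (fam a p q r)"
proof -
  have socle: "unit_vec 3 2 \<in> V" if inv: "invariant_subspace 3 (fam a p q r) V" and nz: "V \<noteq> {0\<^sub>v 3}" for V
  proof -
    have sub: "subspace class_ring V (module_vec TYPE('a) 3)" using inv by (simp add: invariant_subspace_def)
    then interpret S: LinearCombinations.submodule class_ring V "module_vec TYPE('a) 3"
      by (simp add: VectorSpace.subspace_def)
    have smult: "c \<cdot>\<^sub>v v \<in> V" if "v \<in> V" for c v
      using S.smult_closed[of c v] that by (simp add: module_vec_simps)
    have add: "v + w \<in> V" if "v \<in> V" "w \<in> V" for v w
      using S.m_closed that by (simp add: module_vec_simps)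
    obtain v where v: "v \<in> V" "v \<noteq> 0\<^sub>v 3" using nz S.zero_closed by (auto simp: module_vec_simps)
    have vc: "v \<in> carrier_vec 3" using S.subset v by (auto simp: module_vec_simps)
    have last: "unit_vec 3 2 \<in> V" if u: "u \<in> V" "u \<in> carrier_vec 3" "u $ 0 = 0" "u $ 1 = 0" "u $ 2 \<noteq> 0" for u
    proof -
      have "inverse (u $ 2) \<cdot>\<^sub>v u = unit_vec 3 2"
        using u by (intro eq_vecI) (auto simp: less_Suc_eq eval_nat_numeral)
      with smult[OF u(1)] show ?thesis by metis
    qed
    show ?thesis
    proof (cases "v $ 0 = 0 \<and> v $ 1 = 0")
      case True
      have "v $ 2 \<noteq> 0"
      proof
        assume "v $ 2 = 0"
        with True have "v = 0\<^sub>v 3" using vc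
          by (intro eq_vecI) (auto simp: less_Suc_eq eval_nat_numeral)
        with v show False by simp
      qed
      with True last v vc show ?thesis by blast
    next
      case False
      then obtain x y where xy: "a * x * v $ 0 = 0"
        "(p * x + q * y) * v $ 0 + (q * x + r * y) * v $ 1 \<noteq> 0" using hit by blast
      let ?m = "row_vec_mult v (lin_part (elem a p q r 1 x y 0))"
      have "?m \<in> V" using inv v(1) unfolding invariant_subspace_def fam_def by blast
      \<comment> \<open>This is \<open>v\<close> times the linear part minus the identity: its
        coordinates are 0, \<open>a * x * v $ 0\<close>, which vanishes by choice, and a nonzero
        last one.\<close>
      then have "?m + (- 1) \<cdot>\<^sub>v v \<in> V" by (intro add smult v)
      then show ?thesis
        by (rule last) (use vc xy in \<open>auto simp: row_vec_mult_lin_part_elem\<close>)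
    qed
  qed
  have "unit_vec 3 2 \<noteq> (0\<^sub>v 3 :: 'a vec)"
  proof
    assume "unit_vec 3 2 = (0\<^sub>v 3 :: 'a vec)"
    then have "unit_vec 3 2 $ 2 = (0\<^sub>v 3 :: 'a vec) $ 2" by (rule arg_cong)
    then show False by simp
  qed
  with socle show ?thesis unfolding indecomposable_def by blast
qed

section \<open>Conjugation invariants of the nilpotent parts\<close>

lemma mult_carrier_mat_square [simp]:
  "A \<in> carrier_mat n n \<Longrightarrow> B \<in> carrier_mat n n \<Longrightarrow> A * B \<in> carrier_mat n n"
  by (rule mult_carrier_mat)

lemma minus_one_mult:
  fixes g M K :: "'a::field mat"
  assumes "g \<in> carrier_mat n n" "M \<in> carrier_mat n n" "K \<in> carrier_mat n n" "g * M = K * g"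
  shows "g * (M - 1\<^sub>m n) = (K - 1\<^sub>m n) * g"
  using assms by (simp add: mult_minus_distrib_mat[of _ n n _ n] minus_mult_distrib_mat[of _ n n _ _ n])

text \<open>The matrices \<open>M - 1\<close> for \<open>M\<close> in \<open>fam a p q r\<close>: a
  copy of the three-dimensional algebra inside the matrices.\<close>

definition nil :: "'a::field \<Rightarrow> 'a \<Rightarrow> 'a \<Rightarrow> 'a \<Rightarrow> 'a mat set" where
  "nil a p q r = {elem a p q r 0 x y z | x y z. True}"

text \<open>Abstracts conjugation by a fixed matrix. Asking for the algebraic laws on all 4 by 4
  matrices allows products to be transported without locating them in \<open>A\<close>
  first.\<close>

definition nil_embedding :: "('a::field mat \<Rightarrow> 'a mat) \<Rightarrow> 'a mat set \<Rightarrow> 'a mat set \<Rightarrow> bool" where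
  "nil_embedding \<phi> A B \<longleftrightarrow> (\<forall>M \<in> A. \<phi> M \<in> B) \<and>
     (\<forall>M \<in> carrier_mat 4 4. \<forall>N \<in> carrier_mat 4 4. \<phi> (M * N) = \<phi> M * \<phi> N) \<and>
     (\<forall>M \<in> carrier_mat 4 4. \<phi> M = 0\<^sub>m 4 4 \<longleftrightarrow> M = 0\<^sub>m 4 4) \<and>
     (\<forall>k. \<forall>M \<in> carrier_mat 4 4. \<phi> (k \<cdot>\<^sub>m M) = k \<cdot>\<^sub>m \<phi> M)"

lemma nil_embeddingD:
  assumes "nil_embedding \<phi> (nil a p q r) (nil b s t u)"
  shows "\<exists>x' y' z'. \<phi> (elem a p q r 0 x y z) = elem b s t u 0 x' y' z'"
    and "M \<in> carrier_mat 4 4 \<Longrightarrow> N \<in> carrier_mat 4 4 \<Longrightarrow> \<phi> (M * N) = \<phi> M * \<phi> N"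
    and "M \<in> carrier_mat 4 4 \<Longrightarrow> \<phi> M = 0\<^sub>m 4 4 \<longleftrightarrow> M = 0\<^sub>m 4 4"
    and "M \<in> carrier_mat 4 4 \<Longrightarrow> \<phi> (k \<cdot>\<^sub>m M) = k \<cdot>\<^sub>m \<phi> M"
proof -
  have "elem a p q r 0 x y z \<in> nil a p q r" unfolding nil_def by blast
  then have "\<phi> (elem a p q r 0 x y z) \<in> nil b s t u" using assms by (simp add: nil_embedding_def)
  then show "\<exists>x' y' z'. \<phi> (elem a p q r 0 x y z) = elem b s t u 0 x' y' z'"
    unfolding nil_def by blast
qed (use assms in \<open>simp_all add: nil_embedding_def\<close>)

text \<open>The map is \<open>M \<mapsto> g M f\<close> with \<open>f\<close> inverse to
  \<open>g\<close>. Subtracting the identity from an intertwining relation leaves one between the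
  nilpotent parts.\<close>

lemma conj_fam_imp_nil_embedding:
  assumes conj: "conj_in (AGL 3) (fam a p q r) (fam b s t u)" and ar: "a * r = 0" and bu: "b * u = 0"
  obtains \<phi> :: "'a::field mat \<Rightarrow> 'a mat" where "nil_embedding \<phi> (nil a p q r) (nil b s t u)"
proof -
  interpret AGL: group "AGL 3 :: 'a mat monoid" by (rule group_AGL)
  obtain g where g: "g \<in> carrier (AGL 3)"
    and img: "\<And>h. h \<in> fam a p q r \<Longrightarrow> \<exists>k \<in> fam b s t u. g * h = k * g"
    using conj unfolding AGL.conj_in_iff[OF fam_subset_AGL[OF ar] fam_subset_AGL[OF bu]] AGL_simps
    by blast
  then obtain f where c: "g \<in> carrier_mat 4 4" "f \<in> carrier_mat 4 4"
    and fg: "f * g = 1\<^sub>m 4" and gf: "g * f = 1\<^sub>m 4"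
    unfolding carrier_AGL_3 affine4_def by blast
  note assoc = assoc_mult_mat[of _ 4 4 _ 4 _ 4]
  define \<phi> where "\<phi> M = g * M * f" for M
  have canc: "f * (g * M) = M" "g * (f * M) = M" if "M \<in> carrier_mat 4 4" for M
    using c that fg gf assoc[of f g M] assoc[of g f M] by simp_all
  show ?thesis
  proof (rule that[of \<phi>], unfold nil_embedding_def, intro conjI ballI allI)
    fix M assume "M \<in> nil a p q r"
    then obtain x y z where M: "M = elem a p q r 0 x y z" unfolding nil_def by blast
    have "elem a p q r 1 x y z \<in> fam a p q r" unfolding fam_def by blast
    then obtain x' y' z' where e: "g * elem a p q r 1 x y z = elem b s t u 1 x' y' z' * g"
      using img unfolding fam_def by blast
    have one: "elem d e h l 1 x y z - 1\<^sub>m 4 = elem d e h l 0 x y z" for d e h l x y z :: 'a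
      by (simp add: elem_def ut_one ut_minus)
    have "g * elem a p q r 0 x y z = elem b s t u 0 x' y' z' * g"
      using minus_one_mult[OF c(1) _ _ e] by (simp add: one)
    then have "\<phi> (elem a p q r 0 x y z) = elem b s t u 0 x' y' z'"
      using c gf by (simp add: \<phi>_def assoc)
    then show "\<phi> M \<in> nil b s t u" unfolding M nil_def by blast
  next
    fix M N :: "'a mat" assume MN: "M \<in> carrier_mat 4 4" "N \<in> carrier_mat 4 4"
    then show "\<phi> (M * N) = \<phi> M * \<phi> N" using c by (simp add: \<phi>_def assoc canc)
  next
    fix M :: "'a mat" assume M: "M \<in> carrier_mat 4 4"
    have "M = f * \<phi> M * g" using M c fg by (simp add: \<phi>_def assoc canc)
    then show "\<phi> M = 0\<^sub>m 4 4 \<longleftrightarrow> M = 0\<^sub>m 4 4" using c by (auto simp: \<phi>_def)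
  next
    fix k and M :: "'a mat" assume M: "M \<in> carrier_mat 4 4"
    then show "\<phi> (k \<cdot>\<^sub>m M) = k \<cdot>\<^sub>m \<phi> M" using c
      by (simp add: \<phi>_def mult_smult_distrib[of _ 4 4 _ 4] mult_smult_assoc_mat[of _ 4 4 _ 4])
  qed
qed

lemma elem_mult_nil:
  assumes "a * r = 0"
  shows "elem a p q r 0 x y z * elem a p q r 0 x' y' z' =
    elem a p q r 0 0 (a * x * x') (p * x * x' + q * (x * y' + y * x') + r * y * y')"
  by (simp add: elem_mult[OF assms])

lemma elem_zero_iff: "elem a p q r 0 x y z = 0\<^sub>m 4 4 \<longleftrightarrow> x = 0 \<and> y = 0 \<and> z = 0"
  by (simp add: elem_zero[of a p q r])

text \<open>The cube of the first basis vector is \<open>a * q\<close> times the third, whereas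
  cubes in the target carry a factor \<open>b * t\<close> or \<open>b * u\<close>.\<close>

lemma not_conj_if_cube_nonzero:
  assumes "a * r = 0" "b * u = 0" "a * q \<noteq> 0" "b * t = 0"
  shows "\<not> conj_in (AGL 3) (fam a p q r) (fam b s t u)"
proof
  assume "conj_in (AGL 3) (fam a p q r) (fam b s t u)"
  from conj_fam_imp_nil_embedding[OF this assms(1,2)] obtain \<phi> where iso: "nil_embedding \<phi> (nil a p q r) (nil b s t u)" by blast
  note 1 = nil_embeddingD(1)[OF iso] and 2 = nil_embeddingD(2)[OF iso] and 3 = nil_embeddingD(3)[OF iso]
    and 4 = nil_embeddingD(4)[OF iso]
  let ?e = "elem a p q r 0 1 0 0"
  obtain x y z where e: "\<phi> ?e = elem b s t u 0 x y z" using 1 by blast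
  have "\<phi> (?e * (?e * ?e)) = \<phi> ?e * (\<phi> ?e * \<phi> ?e)" by (simp add: 2)
  also have "\<dots> = 0\<^sub>m 4 4"
    unfolding e using assms(2,4) by (auto simp: elem_mult_nil[OF assms(2)] elem_zero_iff algebra_simps)
  finally have "?e * (?e * ?e) = 0\<^sub>m 4 4" by (simp add: 3)
  then show False using assms(3) by (simp add: elem_mult_nil[OF assms(1)] elem_zero_iff)
qed

text \<open>Squares in the target are \<open>2 * t * x * y\<close> times the third basis vector. The
  condition on \<open>t\<close> covers \<open>S_211\<close> in general and \<open>U_13\<close> in
  characteristic 2.\<close>

lemma not_conj_if_square_nonzero:
  assumes "a * r = 0" "a \<noteq> 0 \<or> p \<noteq> 0" "(2::'a::field) * t = 0"
  shows "\<not> conj_in (AGL 3) (fam a p q r) (fam 0 0 t 0)"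
proof
  assume "conj_in (AGL 3) (fam a p q r) (fam 0 0 t 0)"
  from conj_fam_imp_nil_embedding[OF this assms(1) mult_zero_left] obtain \<phi> where iso: "nil_embedding \<phi> (nil a p q r) (nil 0 0 t 0)" by blast
  note 1 = nil_embeddingD(1)[OF iso] and 2 = nil_embeddingD(2)[OF iso] and 3 = nil_embeddingD(3)[OF iso]
    and 4 = nil_embeddingD(4)[OF iso]
  let ?e = "elem a p q r 0 1 0 0"
  obtain x y z where e: "\<phi> ?e = elem 0 0 t 0 0 x y z" using 1 by blast
  have "t * (x * y + y * x) = (2 * t) * (x * y)" by (simp add: algebra_simps)
  then have "\<phi> (?e * ?e) = 0\<^sub>m 4 4"
    using assms(3) by (simp add: 2 e elem_mult_nil elem_zero_iff)
  then have "?e * ?e = 0\<^sub>m 4 4" by (simp add: 3)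
  then show False using assms(2) by (simp add: elem_mult_nil[OF assms(1)] elem_zero_iff)
qed

lemma not_conj_if_product_nonzero:
  assumes "q \<noteq> 0"
  shows "\<not> conj_in (AGL 3) (fam 0 0 q 0) (fam 0 0 0 (0::'a::field))"
proof
  assume "conj_in (AGL 3) (fam 0 0 q 0) (fam 0 0 0 (0::'a))"
  from conj_fam_imp_nil_embedding[OF this mult_zero_left mult_zero_left] obtain \<phi> where iso: "nil_embedding \<phi> (nil 0 0 q 0) (nil 0 0 0 (0::'a))" by blast
  note 1 = nil_embeddingD(1)[OF iso] and 2 = nil_embeddingD(2)[OF iso] and 3 = nil_embeddingD(3)[OF iso]
    and 4 = nil_embeddingD(4)[OF iso]
  let ?e = "elem 0 0 q 0 0 1 0 0" and ?f = "elem 0 0 q 0 0 0 1 0"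
  obtain x y z where e: "\<phi> ?e = elem 0 0 0 0 0 x y z" using 1 by blast
  obtain x' y' z' where f: "\<phi> ?f = elem 0 0 0 0 0 x' y' z'" using 1 by blast
  have "\<phi> (?e * ?f) = 0\<^sub>m 4 4"
    unfolding 2[OF elem_carrier elem_carrier] e f by (simp add: elem_mult_nil elem_zero_iff)
  then have "?e * ?f = 0\<^sub>m 4 4" by (simp add: 3)
  then show False using assms by (simp add: elem_mult_nil elem_zero_iff)
qed

text \<open>In the target a product is \<open>x * x'\<close> times a fixed vector, so two elements
  with nonzero squares have a nonzero product. The first two basis vectors of the source violate
  this.\<close>

lemma not_conj_R_S_31:
  assumes l: "l \<noteq> (0::'a::field)"
  shows "\<not> conj_in (AGL 3) (fam 0 1 0 l) (fam 1 0 0 0)"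
proof
  assume "conj_in (AGL 3) (fam 0 1 0 l) (fam 1 0 0 0)"
  from conj_fam_imp_nil_embedding[OF this mult_zero_left mult_zero_right] obtain \<phi> where iso: "nil_embedding \<phi> (nil 0 1 0 l) (nil 1 0 0 0)" by blast
  note 1 = nil_embeddingD(1)[OF iso] and 2 = nil_embeddingD(2)[OF iso] and 3 = nil_embeddingD(3)[OF iso]
    and 4 = nil_embeddingD(4)[OF iso]
  let ?e = "elem 0 1 0 l 0 1 0 0" and ?f = "elem 0 1 0 l 0 0 1 0"
  obtain x y z where e: "\<phi> ?e = elem 1 0 0 0 0 x y z" using 1 by blast
  obtain x' y' z' where f: "\<phi> ?f = elem 1 0 0 0 0 x' y' z'" using 1 by blast
  have "?e * ?f = 0\<^sub>m 4 4" by (simp add: elem_mult_nil elem_zero_iff)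
  then have ef: "\<phi> ?e * \<phi> ?f = 0\<^sub>m 4 4" by (simp add: 3 flip: 2)
  have "?e * ?e \<noteq> 0\<^sub>m 4 4" by (simp add: elem_mult_nil elem_zero_iff)
  then have ee: "\<phi> ?e * \<phi> ?e \<noteq> 0\<^sub>m 4 4" by (simp add: 3 flip: 2)
  have "?f * ?f \<noteq> 0\<^sub>m 4 4" using l by (simp add: elem_mult_nil elem_zero_iff)
  then have ff: "\<phi> ?f * \<phi> ?f \<noteq> 0\<^sub>m 4 4" by (simp add: 3 flip: 2)
  show False using ee ef ff unfolding e f by (simp add: elem_mult_nil elem_zero_iff)
qed

text \<open>The images of the first two basis vectors have Gram matrix \<open>k * diag(1, l)\<close>
  for the form \<open>diag(1, m)\<close>. Comparing determinants gives
  \<open>l * k^2 = m * d^2\<close>, where \<open>d\<close> is the determinant of their first two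
  coordinates.\<close>

lemma conj_R_imp_square_quotient:
  fixes l m :: "'a::field"
  assumes l: "l \<noteq> 0" and conj: "conj_in (AGL 3) (fam 0 1 0 l) (fam 0 1 0 m)"
  shows "\<exists>s. s \<noteq> 0 \<and> l = m * (s * s)"
proof -
  from conj_fam_imp_nil_embedding[OF conj mult_zero_left mult_zero_left] obtain \<phi> where iso: "nil_embedding \<phi> (nil 0 1 0 l) (nil 0 1 0 m)" by blast
  note 1 = nil_embeddingD(1)[OF iso] and 2 = nil_embeddingD(2)[OF iso] and 3 = nil_embeddingD(3)[OF iso]
    and 4 = nil_embeddingD(4)[OF iso]
  let ?e = "elem 0 1 0 l 0 1 0 0" and ?f = "elem 0 1 0 l 0 0 1 0"
  obtain x y z where e: "\<phi> ?e = elem 0 1 0 m 0 x y z" using 1 by blast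
  obtain x' y' z' where f: "\<phi> ?f = elem 0 1 0 m 0 x' y' z'" using 1 by blast
  have "?e * ?f = 0\<^sub>m 4 4" by (simp add: elem_mult_nil elem_zero_iff)
  then have "\<phi> ?e * \<phi> ?f = 0\<^sub>m 4 4" by (simp add: 3 flip: 2)
  then have ef: "x * x' + m * y * y' = 0" unfolding e f by (simp add: elem_mult_nil elem_zero_iff)
  have "?e * ?e \<noteq> 0\<^sub>m 4 4" by (simp add: elem_mult_nil elem_zero_iff)
  then have "\<phi> ?e * \<phi> ?e \<noteq> 0\<^sub>m 4 4" by (simp add: 3 flip: 2)
  then have k: "x * x + m * y * y \<noteq> 0" (is "?k \<noteq> 0")
    unfolding e by (simp add: elem_mult_nil elem_zero_iff)
  have "?f * ?f = l \<cdot>\<^sub>m (?e * ?e)" by (simp add: elem_mult_nil elem_smult)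
  then have "\<phi> ?f * \<phi> ?f = l \<cdot>\<^sub>m (\<phi> ?e * \<phi> ?e)" by (simp add: 4 flip: 2)
  then have ff: "x' * x' + m * y' * y' = l * ?k" unfolding e f by (simp add: elem_mult_nil elem_smult)
  define d where "d = x * y' - y * x'"
  \<comment> \<open>Lagrange's identity for the form \<open>diag(1, m)\<close>; it involves no
    division by 2.\<close>
  have "?k * (x' * x' + m * y' * y') = (x * x' + m * y * y') * (x * x' + m * y * y') + m * (d * d)"
    unfolding d_def by (simp add: algebra_simps)
  then have "l * (?k * ?k) = m * (d * d)" unfolding ef ff by (simp add: algebra_simps)
  moreover have "?k * ?k \<noteq> 0" using k by simp
  ultimately have "l = m * (d * d) / (?k * ?k)" by (metis nonzero_eq_divide_eq)
  then have "l = m * (d / ?k * (d / ?k))" by simp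
  moreover from this have "d / ?k \<noteq> 0" using l by auto
  ultimately show ?thesis by blast
qed

section \<open>Square classes and the complete list of representatives\<close>

lemma carrier_field_units: "carrier (field_units :: 'a::field monoid) = {x. x \<noteq> 0}"
proof -
  have "Units (class_ring :: 'a ring) = {x. x \<noteq> 0}"
    by (auto simp: Units_def) (metis left_inverse right_inverse)
  then show ?thesis by (simp add: field_units_def units_of_def)
qed

lemma transversal_unit_squaresD:
  fixes T :: "'a::field set"
  assumes "is_transversal field_units unit_squares T"
  shows "l \<in> T \<Longrightarrow> l \<noteq> 0"
    and "b \<noteq> 0 \<Longrightarrow> \<exists>l \<in> T. \<exists>s. s \<noteq> 0 \<and> l = s * s * b"
    and "\<lbrakk>l \<in> T; m \<in> T; s \<noteq> 0; l = m * (s * s)\<rbrakk> \<Longrightarrow> l = m"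
proof -
  have T: "T \<subseteq> {x. x \<noteq> 0}" and ex1: "\<And>C. C \<in> rcosets\<^bsub>field_units\<^esub> unit_squares \<Longrightarrow> \<exists>!t. t \<in> T \<inter> C"
    using assms unfolding is_transversal_def carrier_field_units by blast+
  have mult: "x \<otimes>\<^bsub>field_units\<^esub> y = x * y" for x y :: 'a
    by (simp add: field_units_def units_of_def)
  have coset: "unit_squares #>\<^bsub>field_units\<^esub> b = {s * s * b | s. s \<noteq> 0}" for b :: 'a
    unfolding r_coset_def unit_squares_def carrier_field_units mult by blast
  have cosets: "{s * s * b | s. s \<noteq> 0} \<in> rcosets\<^bsub>field_units\<^esub> unit_squares" if "b \<noteq> 0" for b :: 'a
    unfolding RCOSETS_def coset carrier_field_units using that by blast
  show nz: "l \<in> T \<Longrightarrow> l \<noteq> 0" for l using T by blast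
  show "\<exists>l \<in> T. \<exists>s. s \<noteq> 0 \<and> l = s * s * b" if "b \<noteq> 0"
    using ex1[OF cosets[OF that]] by blast
  assume l: "l \<in> T" and m: "m \<in> T" and s: "s \<noteq> 0" and lm: "l = m * (s * s)"
  have "l \<in> {s * s * m | s. s \<noteq> 0}" using lm s by (auto simp: mult.commute)
  moreover have "m = 1 * 1 * m" by simp
  then have "m \<in> {s * s * m | s. s \<noteq> 0}" by fastforce
  ultimately show "l = m" using ex1[OF cosets[OF nz[OF m]]] l m by blast
qed

lemma complete_set_of_reps:
  fixes T :: "'a::field set"
  assumes T: "is_transversal field_units unit_squares T"
  shows "is_complete_set_of_reps (conj_in (AGL 3)) (abelian_regular_subgroups 3)
       ({S_4, S_31, S_211} \<union> R_sub ` T \<union> (if CHAR('a) = 2 then {U_13} else {}))"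
    (is "is_complete_set_of_reps _ _ ?L")
proof -
  interpret AGL: group "AGL 3 :: 'a mat monoid" by (rule group_AGL)
  note T_D = transversal_unit_squaresD[OF T]
  have char2: "CHAR('a) = 2 \<longleftrightarrow> (2::'a) = 0"
  proof
    assume "CHAR('a) = 2"
    then show "(2::'a) = 0" using of_nat_CHAR[where 'a='a] by simp
  next
    assume "(2::'a) = 0"
    then have "of_nat 2 = (0::'a)" by simp
    then have "CHAR('a) dvd 2" by (rule of_nat_eq_0_iff_char_dvd[THEN iffD1])
    moreover have "CHAR('a) \<noteq> 1" by simp
    ultimately show "CHAR('a) = 2" using prime_nat_iff two_is_prime_nat by blast
  qed
  have sub: "R \<subseteq> carrier (AGL 3)" if "R \<in> abelian_regular_subgroups 3" for R :: "'a mat set"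
    using that by (intro abelian_regular_3.R_subset abelian_regular_3.intro)
  have L: "?L \<subseteq> abelian_regular_subgroups 3"
    by (auto simp: fam_instances intro!: fam_abelian_regular)
  have exists: "\<exists>t \<in> ?L. conj_in (AGL 3) R t" if R: "R \<in> abelian_regular_subgroups 3" for R
  proof -
    interpret R: abelian_regular_3 R by (rule abelian_regular_3.intro[OF R])
    consider u v w where "R.table u v w 1 0 1 0" | u v w where "R.table u v w 1 0 0 0"
      | u v w where "R.table u v w 0 0 0 0" | u v w b where "b \<noteq> 0" "R.table u v w 0 1 0 b"
      | u v w where "(2::'a) = 0" "R.table u v w 0 0 1 0"
      using R.classification by metis
    then show ?thesis
    proof cases
      case 1
      then have "conj_in (AGL 3) R S_4" unfolding fam_instances by (rule R.table_imp_conj_fam) simp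
      then show ?thesis by blast
    next
      case 2
      then have "conj_in (AGL 3) R S_31" unfolding fam_instances by (rule R.table_imp_conj_fam) simp
      then show ?thesis by blast
    next
      case 3
      then have "conj_in (AGL 3) R S_211" unfolding fam_instances by (rule R.table_imp_conj_fam) simp
      then show ?thesis by blast
    next
      case 4
      then obtain l s where l: "l \<in> T" "s \<noteq> 0" "l = s * s * b" using T_D(2) by blast
      have "conj_in (AGL 3) R (R_sub l)" unfolding fam_instances l(3)
        by (rule R.table_imp_conj_fam[OF R.table_rescale[OF 4(2) l(2)]]) simp
      with l(1) show ?thesis by blast
    next
      case 5
      then have "conj_in (AGL 3) R U_13" unfolding fam_instances by (intro R.table_imp_conj_fam) simp_all
      with 5(1) char2 show ?thesis by auto
    qed
  qed
  have nc: "\<not> conj_in (AGL 3) S_4 (S_31 :: 'a mat set)" "\<not> conj_in (AGL 3) S_4 (S_211 :: 'a mat set)"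
    "\<not> conj_in (AGL 3) S_4 (U_13 :: 'a mat set)" "\<And>l. \<not> conj_in (AGL 3) S_4 (R_sub (l::'a))"
    "\<not> conj_in (AGL 3) S_31 (S_211 :: 'a mat set)" "\<And>l. \<not> conj_in (AGL 3) (R_sub (l::'a)) S_211"
    "\<not> conj_in (AGL 3) U_13 (S_211 :: 'a mat set)"
    "\<And>l. l \<in> T \<Longrightarrow> \<not> conj_in (AGL 3) (R_sub l) S_31"
    unfolding fam_instances
    by (simp_all add: not_conj_if_cube_nonzero not_conj_if_square_nonzero
        not_conj_if_product_nonzero not_conj_R_S_31 T_D(1))
  \<comment> \<open>These two separations rest on squares vanishing in \<open>U_13\<close>, hence on
    characteristic 2.\<close>
  have nc2: "\<not> conj_in (AGL 3) S_31 (U_13 :: 'a mat set)" "\<not> conj_in (AGL 3) (R_sub (l::'a)) U_13"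
    if "CHAR('a) = 2" for l
    using that unfolding fam_instances char2 by (simp_all add: not_conj_if_square_nonzero)
  have ncR: "l = m" if "l \<in> T" "m \<in> T" "conj_in (AGL 3) (R_sub l) (R_sub m)" for l m
    using conj_R_imp_square_quotient[of l m] that T_D(1,3) unfolding fam_instances by blast
  have unique: "t = t'" if "t \<in> ?L" "t' \<in> ?L" and c: "conj_in (AGL 3) t t'" for t t'
  proof -
    \<comment> \<open>Each pair of types was separated in one direction only; symmetry of conjugacy
      supplies the other.\<close>
    have c': "conj_in (AGL 3) t' t" 
      using AGL.conj_in_sym[OF sub sub c] that(1,2) L by (simp only: subset_iff)
    have cases: "s = S_4 \<or> s = S_31 \<or> s = S_211 \<or> (\<exists>l \<in> T. s = R_sub l) \<or> CHAR('a) = 2 \<and> s = U_13"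
      if "s \<in> ?L" for s using that by (auto split: if_splits)
    from cases[OF that(1)] cases[OF that(2)] show "t = t'"
      by (elim disjE bexE conjE)
        ((use c c' in \<open>simp add: nc nc2; fail\<close>) | (use c ncR in blast))+
  qed
  show ?thesis unfolding is_complete_set_of_reps_def
  proof (intro conjI ballI L)
    fix R :: "'a mat set" assume R: "R \<in> abelian_regular_subgroups 3"
    show "\<exists>!t. t \<in> ?L \<and> conj_in (AGL 3) R t"
    proof (rule ex_ex1I)
      show "\<exists>t. t \<in> ?L \<and> conj_in (AGL 3) R t" using exists[OF R] by blast
    next
      fix t t' assume t: "t \<in> ?L \<and> conj_in (AGL 3) R t" and t': "t' \<in> ?L \<and> conj_in (AGL 3) R t'"
      have s: "R \<subseteq> carrier (AGL 3)" "t \<subseteq> carrier (AGL 3)" "t' \<subseteq> carrier (AGL 3)"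
        using sub R t t' L by blast+
      have "conj_in (AGL 3) t t'"
        using AGL.conj_in_trans[OF s(2,1,3)] AGL.conj_in_sym[OF s(1,2)] t t' by blast
      then show "t = t'" using unique t t' by blast
    qed
  qed
qed

section \<open>Polynomial presentations\<close>

abbreviation monom_pow :: "nat \<Rightarrow> nat \<Rightarrow> (nat \<Rightarrow>\<^sub>0 nat)" where
  "monom_pow \<equiv> Poly_Mapping.single"

text \<open>A finite set of decompositions of \<open>k\<close> turns the convolution defining the
  product into an ordinary finite sum.\<close>

lemma lookup_mult_antidiagonal:
  fixes p q :: "'m::monoid_add \<Rightarrow>\<^sub>0 'a::semiring_0"
  assumes "finite D" "\<And>a b. a + b = k \<longleftrightarrow> (a, b) \<in> D"
  shows "Poly_Mapping.lookup (p * q) k =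
    (\<Sum>(a, b) \<in> D. Poly_Mapping.lookup p a * Poly_Mapping.lookup q b)"
proof -
  have "Poly_Mapping.lookup (p * q) k =
      (\<Sum>(a, b). Poly_Mapping.lookup p a * Poly_Mapping.lookup q b when k = a + b)"
    unfolding times_poly_mapping.rep_eq by (rule prod_fun_unfold_prod) simp_all
  also have "\<dots> = (\<Sum>(a, b) \<in> D. Poly_Mapping.lookup p a * Poly_Mapping.lookup q b when k = a + b)"
    using assms(1) by (intro Sum_any.expand_superset) (auto simp: assms(2)[symmetric])
  also have "\<dots> = (\<Sum>(a, b) \<in> D. Poly_Mapping.lookup p a * Poly_Mapping.lookup q b)"
    by (intro sum.cong) (auto simp: when_def simp flip: assms(2))
  finally show ?thesis .
qed

text \<open>The coefficient of the monomial with exponents \<open>i\<close> and \<open>j\<close> in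
  variables \<open>u\<close> and \<open>v\<close> and exponent 0 in all others. The indices are
  parameters because three variables are handled through the pairs (1, 2) and (1, 3).\<close>

definition coeff2 :: "nat \<Rightarrow> nat \<Rightarrow> 'a::field mpolynomial \<Rightarrow> nat \<Rightarrow> nat \<Rightarrow> 'a" where
  "coeff2 u v p i j = Poly_Mapping.lookup p (monom_pow u i + monom_pow v j)"

lemma lookup_monom2:
  assumes "u \<noteq> v"
  shows "Poly_Mapping.lookup (monom_pow u i + monom_pow v j) k = (if k = u then i else if k = v then j else 0)"
  using assms by (auto simp: lookup_add lookup_single when_def)

lemma monom2_eq_iff:
  assumes "u \<noteq> v"
  shows "monom_pow u a + monom_pow v b = monom_pow u i + monom_pow v j \<longleftrightarrow> a = i \<and> b = j"
  using lookup_monom2[OF assms] assms by metis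

text \<open>Exponents are natural numbers, so nothing cancels: the factors of a monomial in two
  variables involve no third one.\<close>

lemma monom2_antidiagonal:
  assumes uv: "u \<noteq> v"
  shows "m + n = monom_pow u i + monom_pow v j \<longleftrightarrow>
    (m, n) \<in> (\<lambda>(a, b). (monom_pow u a + monom_pow v b, monom_pow u (i - a) + monom_pow v (j - b))) ` ({..i} \<times> {..j})"
    (is "?l \<longleftrightarrow> _ \<in> ?f ` _")
proof
  assume ?l
  then have sum: "Poly_Mapping.lookup m k + Poly_Mapping.lookup n k = (if k = u then i else if k = v then j else 0)" for k
    using lookup_monom2[OF uv] by (metis lookup_add)
  let ?a = "Poly_Mapping.lookup m u" and ?b = "Poly_Mapping.lookup m v"
  have "m = monom_pow u ?a + monom_pow v ?b"
  proof (rule poly_mapping_eqI)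
    fix k
    show "Poly_Mapping.lookup m k = Poly_Mapping.lookup (monom_pow u ?a + monom_pow v ?b) k"
      using sum[of k] uv by (auto simp: lookup_monom2[OF uv])
  qed
  moreover have "n = monom_pow u (i - ?a) + monom_pow v (j - ?b)"
  proof (rule poly_mapping_eqI)
    fix k
    show "Poly_Mapping.lookup n k = Poly_Mapping.lookup (monom_pow u (i - ?a) + monom_pow v (j - ?b)) k"
      using sum[of k] uv by (auto simp: lookup_monom2[OF uv])
  qed
  moreover have "?a \<le> i" "?b \<le> j" using sum[of u] sum[of v] uv by auto
  ultimately show "(m, n) \<in> ?f ` ({..i} \<times> {..j})" by (intro image_eqI[of _ _ "(?a, ?b)"]) auto
next
  assume "(m, n) \<in> ?f ` ({..i} \<times> {..j})"
  then obtain a b where "a \<le> i" "b \<le> j" "m = monom_pow u a + monom_pow v b"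
    "n = monom_pow u (i - a) + monom_pow v (j - b)" by auto
  then show ?l using uv
    by (intro poly_mapping_eqI) (auto simp: lookup_monom2[OF uv] lookup_add lookup_single when_def)
qed

lemma coeff2_mult:
  assumes "u \<noteq> v"
  shows "coeff2 u v (p * q) i j = (\<Sum>a\<le>i. \<Sum>b\<le>j. coeff2 u v p a b * coeff2 u v q (i - a) (j - b))"
proof -
  let ?f = "\<lambda>(a, b). (monom_pow u a + monom_pow v b, monom_pow u (i - a) + monom_pow v (j - b))"
  have inj: "inj_on ?f ({..i} \<times> {..j})"
    by (auto simp: inj_on_def monom2_eq_iff[OF assms])
  have "coeff2 u v (p * q) i j =
      (\<Sum>(m, n) \<in> ?f ` ({..i} \<times> {..j}). Poly_Mapping.lookup p m * Poly_Mapping.lookup q n)"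
    unfolding coeff2_def
    by (rule lookup_mult_antidiagonal[OF _ monom2_antidiagonal[OF assms]]) simp
  also have "\<dots> = (\<Sum>(a, b) \<in> {..i} \<times> {..j}. coeff2 u v p a b * coeff2 u v q (i - a) (j - b))"
    unfolding sum.reindex[OF inj] by (intro sum.cong) (auto simp: coeff2_def)
  finally show ?thesis by (simp add: sum.cartesian_product)
qed

lemma coeff2_mult_low:
  assumes "u \<noteq> v"
  shows "coeff2 u v (p * q) 0 0 = coeff2 u v p 0 0 * coeff2 u v q 0 0"
    "coeff2 u v (p * q) (Suc 0) 0 = coeff2 u v p 0 0 * coeff2 u v q (Suc 0) 0 + coeff2 u v p (Suc 0) 0 * coeff2 u v q 0 0"
    "coeff2 u v (p * q) 0 (Suc 0) = coeff2 u v p 0 0 * coeff2 u v q 0 (Suc 0) + coeff2 u v p 0 (Suc 0) * coeff2 u v q 0 0"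
    "coeff2 u v (p * q) 2 0 = coeff2 u v p 0 0 * coeff2 u v q 2 0
       + coeff2 u v p (Suc 0) 0 * coeff2 u v q (Suc 0) 0 + coeff2 u v p 2 0 * coeff2 u v q 0 0"
    "coeff2 u v (p * q) 0 2 = coeff2 u v p 0 0 * coeff2 u v q 0 2
       + coeff2 u v p 0 (Suc 0) * coeff2 u v q 0 (Suc 0) + coeff2 u v p 0 2 * coeff2 u v q 0 0"
    "coeff2 u v (p * q) (Suc 0) (Suc 0) = coeff2 u v p 0 0 * coeff2 u v q (Suc 0) (Suc 0)
       + coeff2 u v p (Suc 0) 0 * coeff2 u v q 0 (Suc 0) + coeff2 u v p 0 (Suc 0) * coeff2 u v q (Suc 0) 0
       + coeff2 u v p (Suc 0) (Suc 0) * coeff2 u v q 0 0"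
    "coeff2 u v (p * q) 3 0 = coeff2 u v p 0 0 * coeff2 u v q 3 0 + coeff2 u v p (Suc 0) 0 * coeff2 u v q 2 0
       + coeff2 u v p 2 0 * coeff2 u v q (Suc 0) 0 + coeff2 u v p 3 0 * coeff2 u v q 0 0"
  by (simp_all add: coeff2_mult[OF assms] eval_nat_numeral)

lemma coeff2_add: "coeff2 u v (p + q) i j = coeff2 u v p i j + coeff2 u v q i j"
  by (simp add: coeff2_def lookup_add)

lemma coeff2_diff: "coeff2 u v (p - q) i j = coeff2 u v p i j - coeff2 u v q i j"
  by (simp add: coeff2_def lookup_minus)

lemma coeff2_scale: "coeff2 u v (t_const c * p) i j = c * coeff2 u v p i j"
  unfolding coeff2_def t_const_def mult_map_scale_conv_mult[symmetric]
  by (simp add: Poly_Mapping.map.rep_eq when_def)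

lemma coeff2_one:
  assumes "u \<noteq> v"
  shows "coeff2 u v 1 i j = (if i = 0 \<and> j = 0 then 1 else 0)"
  using monom2_eq_iff[OF assms, of i j 0 0] by (simp add: coeff2_def lookup_one when_def)

lemma coeff2_var:
  assumes "u \<noteq> v"
  shows "coeff2 u v (t_var u) i j = (if i = Suc 0 \<and> j = 0 then 1 else 0)"
    "coeff2 u v (t_var v) i j = (if i = 0 \<and> j = Suc 0 then 1 else 0)"
    "w \<noteq> u \<Longrightarrow> w \<noteq> v \<Longrightarrow> coeff2 u v (t_var w) i j = 0"
proof -
  show "coeff2 u v (t_var u) i j = (if i = Suc 0 \<and> j = 0 then 1 else 0)"
    using monom2_eq_iff[OF assms, of "Suc 0" 0 i j] by (auto simp: coeff2_def t_var_def lookup_single when_def)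
  show "coeff2 u v (t_var v) i j = (if i = 0 \<and> j = Suc 0 then 1 else 0)"
    using monom2_eq_iff[OF assms, of 0 "Suc 0" i j] by (auto simp: coeff2_def t_var_def lookup_single when_def)
  assume "w \<noteq> u" "w \<noteq> v"
  then have "monom_pow w (Suc 0) \<noteq> monom_pow u i + monom_pow v j"
    using lookup_monom2[OF assms, of i j w] by (metis lookup_single_eq nat.simps(3))
  then show "coeff2 u v (t_var w) i j = 0"
    by (simp add: coeff2_def t_var_def lookup_single when_def)
qed

section \<open>The polynomial algebra and its quotients\<close>

lemma poly_alg_simps:
  "mult (poly_alg k) = (*)" "one (poly_alg k) = 1" "zero (poly_alg k) = 0" "add (poly_alg k) = (+)"
  "smult (poly_alg k) = (\<lambda>c p. t_const c * p)"
  by (simp_all add: poly_alg_def)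

lemma carrier_poly_alg:
  "p \<in> carrier (poly_alg k) \<longleftrightarrow> (\<forall>m \<in> Poly_Mapping.keys p. Poly_Mapping.keys m \<subseteq> {1..k})"
  by (simp add: poly_alg_def)

lemma poly_alg_closed:
  "p \<in> carrier (poly_alg k) \<Longrightarrow> q \<in> carrier (poly_alg k) \<Longrightarrow> p + q \<in> carrier (poly_alg k)"
  "p \<in> carrier (poly_alg k) \<Longrightarrow> q \<in> carrier (poly_alg k) \<Longrightarrow> p * q \<in> carrier (poly_alg k)"
  "p \<in> carrier (poly_alg k) \<Longrightarrow> - p \<in> carrier (poly_alg k)"
  "0 \<in> carrier (poly_alg k)" "1 \<in> carrier (poly_alg k)" "t_const c \<in> carrier (poly_alg k)"
  "i \<in> {1..k} \<Longrightarrow> t_var i \<in> carrier (poly_alg k)"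
  unfolding carrier_poly_alg
proof -
  assume p: "\<forall>m \<in> Poly_Mapping.keys p. Poly_Mapping.keys m \<subseteq> {1..k}"
    and q: "\<forall>m \<in> Poly_Mapping.keys q. Poly_Mapping.keys m \<subseteq> {1..k}"
  show "\<forall>m \<in> Poly_Mapping.keys (p + q). Poly_Mapping.keys m \<subseteq> {1..k}"
    using p q Poly_Mapping.keys_add[of p q] by blast
  show "\<forall>m \<in> Poly_Mapping.keys (p * q). Poly_Mapping.keys m \<subseteq> {1..k}"
  proof
    fix m assume "m \<in> Poly_Mapping.keys (p * q)"
    then obtain a b where "m = a + b" "a \<in> Poly_Mapping.keys p" "b \<in> Poly_Mapping.keys q"
      using Poly_Mapping.keys_mult[of p q] by blast
    then show "Poly_Mapping.keys m \<subseteq> {1..k}" using p q Poly_Mapping.keys_add[of a b] by blast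
  qed
next
  assume "\<forall>m \<in> Poly_Mapping.keys p. Poly_Mapping.keys m \<subseteq> {1..k}"
  then show "\<forall>m \<in> Poly_Mapping.keys (- p). Poly_Mapping.keys m \<subseteq> {1..k}"
    by (simp add: in_keys_iff)
qed (auto simp: t_const_def t_var_def)

lemma poly_alg_diff:
  "p \<in> carrier (poly_alg k) \<Longrightarrow> q \<in> carrier (poly_alg k) \<Longrightarrow> p - q \<in> carrier (poly_alg k)"
  using poly_alg_closed(1)[of p k "- q"] poly_alg_closed(3)[of q k] by simp

lemma poly_alg_power: "p \<in> carrier (poly_alg k) \<Longrightarrow> p ^ n \<in> carrier (poly_alg k)"
  by (induction n) (auto intro: poly_alg_closed)

lemma t_const_simps:
  "t_const (a + b) = t_const a + t_const b" "t_const (a * b) = t_const a * t_const b"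
  "t_const 1 = 1" "t_const 0 = 0" "t_const (- a) = - t_const a" "t_const (a - b) = t_const a - t_const b"
  by (simp_all add: t_const_def single_add mult_single single_uminus single_diff)

lemma cring_class_ring: "cring (class_ring :: 'a::field ring)"
  by unfold_locales

lemma algebra_poly_alg: "algebra class_ring (poly_alg k :: ('a::field, 'a mpolynomial) module)"
proof (rule algebraI[OF cring_class_ring])
  show "cring (poly_alg k :: ('a, 'a mpolynomial) module)"
  proof (rule cringI)
    show "abelian_group (poly_alg k :: ('a, 'a mpolynomial) module)"
    proof (rule abelian_groupI)
      fix p :: "'a mpolynomial" assume "p \<in> carrier (poly_alg k)"
      then show "\<exists>q \<in> carrier (poly_alg k). q \<oplus>\<^bsub>poly_alg k\<^esub> p = \<zero>\<^bsub>poly_alg k\<^esub>"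
        by (intro bexI[of _ "- p"]) (auto simp: poly_alg_simps poly_alg_closed)
    qed (auto simp: poly_alg_simps poly_alg_closed algebra_simps)
    show "comm_monoid (poly_alg k :: ('a, 'a mpolynomial) module)"
      by (rule comm_monoidI) (auto simp: poly_alg_simps poly_alg_closed algebra_simps)
  qed (auto simp: poly_alg_simps algebra_simps)
qed (auto simp: poly_alg_simps poly_alg_closed algebra_simps t_const_simps)

text \<open>The laws of the quotient are carried over from \<open>B\<close> along the bijection \<open>h x \<mapsto> I + x\<close>.\<close>

lemma alg_isomorphic_quot_alg:
  fixes A :: "('a::field, 'b) module" and B :: "('a, 'c) module"
  assumes A: "algebra class_ring A" and B: "algebra class_ring B" and I: "ideal I A"
    and closed: "\<And>x. x \<in> carrier A \<Longrightarrow> h x \<in> carrier B"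
    and surj: "\<And>y. y \<in> carrier B \<Longrightarrow> \<exists>x \<in> carrier A. h x = y"
    and add: "\<And>x y. x \<in> carrier A \<Longrightarrow> y \<in> carrier A \<Longrightarrow> h (x \<oplus>\<^bsub>A\<^esub> y) = h x \<oplus>\<^bsub>B\<^esub> h y"
    and mult: "\<And>x y. x \<in> carrier A \<Longrightarrow> y \<in> carrier A \<Longrightarrow> h (x \<otimes>\<^bsub>A\<^esub> y) = h x \<otimes>\<^bsub>B\<^esub> h y"
    and one: "h \<one>\<^bsub>A\<^esub> = \<one>\<^bsub>B\<^esub>"
    and smult: "\<And>c x. x \<in> carrier A \<Longrightarrow> h (c \<odot>\<^bsub>A\<^esub> x) = c \<odot>\<^bsub>B\<^esub> h x"
    and kernel: "\<And>x. x \<in> carrier A \<Longrightarrow> h x = \<zero>\<^bsub>B\<^esub> \<longleftrightarrow> x \<in> I"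
  shows "alg_isomorphic class_ring B (quot_alg A I)"
proof -
  interpret A: algebra class_ring A by fact
  interpret B: algebra class_ring B by fact
  interpret I: ideal I A by fact
  let ?Q = "quot_alg A I"
  have cA: "c \<odot>\<^bsub>A\<^esub> x \<in> carrier A" if "x \<in> carrier A" for c x using A.smult_closed[of c x] that by simp
  have cB: "c \<odot>\<^bsub>B\<^esub> x \<in> carrier B" if "x \<in> carrier B" for c x using B.smult_closed[of c x] that by simp
  have Q: "carrier ?Q = (\<lambda>x. I +>\<^bsub>A\<^esub> x) ` carrier A" "mult ?Q = rcoset_mult A I" "one ?Q = I +>\<^bsub>A\<^esub> \<one>\<^bsub>A\<^esub>"
    "zero ?Q = I" "add ?Q = set_add A"
    by (auto simp: quot_alg_def FactRing_def A_RCOSETS_def')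
  have hom: "ring_hom_ring A B h"
    by (rule ring_hom_ringI2[OF A.ring_axioms B.ring_axioms]) (auto intro!: ring_hom_memI closed add mult one)
  then interpret h: ring_hom_ring A B h .
  have coset_eq: "I +>\<^bsub>A\<^esub> x = I +>\<^bsub>A\<^esub> y \<longleftrightarrow> h x = h y" if xy: "x \<in> carrier A" "y \<in> carrier A" for x y
  proof -
    have "I +>\<^bsub>A\<^esub> x = I +>\<^bsub>A\<^esub> y \<longleftrightarrow> x \<ominus>\<^bsub>A\<^esub> y \<in> I"
      using A.quotient_eq_iff_same_a_r_cos[OF I xy] by simp
    also have "\<dots> \<longleftrightarrow> h (x \<ominus>\<^bsub>A\<^esub> y) = \<zero>\<^bsub>B\<^esub>" using kernel xy by simp
    also have "\<dots> \<longleftrightarrow> h (x \<ominus>\<^bsub>A\<^esub> y) \<oplus>\<^bsub>B\<^esub> h y = h y"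
      using closed xy by simp
    also have "h (x \<ominus>\<^bsub>A\<^esub> y) \<oplus>\<^bsub>B\<^esub> h y = h (x \<ominus>\<^bsub>A\<^esub> y \<oplus>\<^bsub>A\<^esub> y)"
      using add xy by simp
    also have "x \<ominus>\<^bsub>A\<^esub> y \<oplus>\<^bsub>A\<^esub> y = x"
      using xy by (simp add: a_minus_def A.a_assoc A.l_neg)
    finally show ?thesis .
  qed
  \<comment> \<open>Any preimage would do: \<open>coset_eq\<close> makes the coset independent of
    the choice.\<close>
  define f where "f y = I +>\<^bsub>A\<^esub> (SOME x. x \<in> carrier A \<and> h x = y)" for y
  have f: "f (h x) = I +>\<^bsub>A\<^esub> x" if x: "x \<in> carrier A" for x
  proof -
    have "\<exists>x'. x' \<in> carrier A \<and> h x' = h x" using x by blast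
    from someI_ex[OF this] show ?thesis unfolding f_def using coset_eq x by blast
  qed
  \<comment> \<open>All members of a coset lead to the same scaled coset, and a coset is never
    empty, so the union in \<open>quot_alg\<close> collapses to that single value.\<close>
  have smult_Q: "c \<odot>\<^bsub>?Q\<^esub> (I +>\<^bsub>A\<^esub> x) = I +>\<^bsub>A\<^esub> (c \<odot>\<^bsub>A\<^esub> x)" if x: "x \<in> carrier A" for c x
  proof -
    have "I +>\<^bsub>A\<^esub> (c \<odot>\<^bsub>A\<^esub> y) = I +>\<^bsub>A\<^esub> (c \<odot>\<^bsub>A\<^esub> x)" if y: "y \<in> I +>\<^bsub>A\<^esub> x" for y
    proof -
      have yA: "y \<in> carrier A" using y A.a_r_coset_subset_G[OF I.a_subset x] by blast
      have "I +>\<^bsub>A\<^esub> y = I +>\<^bsub>A\<^esub> x" using I.a_repr_independence'[OF y x] by simp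
      then have "h y = h x" using coset_eq x yA by simp
      then show ?thesis using coset_eq x yA by (simp add: cA smult)
    qed
    then have "(\<Union>y \<in> I +>\<^bsub>A\<^esub> x. I +>\<^bsub>A\<^esub> (c \<odot>\<^bsub>A\<^esub> y)) = (\<Union>y \<in> I +>\<^bsub>A\<^esub> x. I +>\<^bsub>A\<^esub> (c \<odot>\<^bsub>A\<^esub> x))"
      by (rule SUP_cong[OF refl])
    also have "\<dots> = I +>\<^bsub>A\<^esub> (c \<odot>\<^bsub>A\<^esub> x)"
      using I.a_rcos_self[OF x] by (simp only: UN_constant) auto
    finally show ?thesis by (simp add: quot_alg_def)
  qed
  have f_closed: "f y \<in> carrier ?Q" if "y \<in> carrier B" for y
    using surj[OF that] f unfolding Q by auto
  have pre_h: "\<exists>x' \<in> carrier A. x = h x'" if "x \<in> carrier B" for x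
    using surj[OF that] by metis
  have f_mult: "f (x \<otimes>\<^bsub>B\<^esub> y) = f x \<otimes>\<^bsub>?Q\<^esub> f y" if xy: "x \<in> carrier B" "y \<in> carrier B" for x y
  proof -
    obtain x' y' where A: "x' \<in> carrier A" "y' \<in> carrier A" and h: "x = h x'" "y = h y'"
      using pre_h xy by metis
    show ?thesis
      unfolding h mult[OF A, symmetric] f[OF A.m_closed[OF A]] f[OF A(1)] f[OF A(2)] Q(2)
      by (rule I.rcoset_mult_add[OF A, symmetric])
  qed
  have f_add: "f (x \<oplus>\<^bsub>B\<^esub> y) = f x \<oplus>\<^bsub>?Q\<^esub> f y" if xy: "x \<in> carrier B" "y \<in> carrier B" for x y
  proof -
    obtain x' y' where A: "x' \<in> carrier A" "y' \<in> carrier A" and h: "x = h x'" "y = h y'"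
      using pre_h xy by metis
    show ?thesis
      unfolding h add[OF A, symmetric] f[OF A.a_closed[OF A]] f[OF A(1)] f[OF A(2)] Q(5)
      by (rule I.a_rcos_sum[OF A, symmetric])
  qed
  have f_smult: "f (c \<odot>\<^bsub>B\<^esub> x) = c \<odot>\<^bsub>?Q\<^esub> f x" if x: "x \<in> carrier B" for c x
  proof -
    obtain x' where A: "x' \<in> carrier A" and h: "x = h x'" using pre_h x by metis
    show ?thesis
      unfolding h smult[OF A, symmetric] f[OF cA[OF A]] f[OF A] smult_Q[OF A] ..
  qed
  have f_one: "f \<one>\<^bsub>B\<^esub> = \<one>\<^bsub>?Q\<^esub>" using f[of "\<one>\<^bsub>A\<^esub>"] by (simp add: Q one)
  have f_zero: "f \<zero>\<^bsub>B\<^esub> = \<zero>\<^bsub>?Q\<^esub>"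
    using f[of "\<zero>\<^bsub>A\<^esub>"] A.a_rcos_zero[OF I I.zero_closed] by (simp add: Q)
  have image: "f ` carrier B = carrier ?Q"
  proof (intro subset_antisym subsetI)
    fix X assume "X \<in> carrier ?Q"
    then obtain x where x: "x \<in> carrier A" "X = I +>\<^bsub>A\<^esub> x" unfolding Q by blast
    then have "X = f (h x)" using f by simp
    then show "X \<in> f ` carrier B" using closed[OF x(1)] by blast
  qed (use f_closed in auto)
  have inj: "inj_on f (carrier B)"
  proof (rule inj_onI)
    fix x y assume xy: "x \<in> carrier B" "y \<in> carrier B" and eq: "f x = f y"
    obtain x' y' where "x' \<in> carrier A" "h x' = x" "y' \<in> carrier A" "h y' = y" using surj xy by metis
    then show "x = y" using eq f coset_eq by metis
  qed
  have iso: "f \<in> ring_iso B ?Q"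
    using f_closed f_mult f_add f_one inj image by (intro ring_iso_memI) (auto simp: bij_betw_def)
  \<comment> \<open>A \<open>ring_iso\<close> need not say anything about the zero of its target, so
    \<open>f_zero\<close> is what identifies the transported zero with that of
    \<open>?Q\<close>.\<close>
  have cring_Q: "cring ?Q"
    using B.ring_iso_imp_img_cring[OF iso] by (simp add: f_zero)
  have pre: "\<exists>x \<in> carrier B. X = f x" if "X \<in> carrier ?Q" for X using that image by blast
  have "algebra class_ring ?Q"
  proof (rule algebraI[OF cring_class_ring cring_Q])
    fix c :: 'a and X assume X: "X \<in> carrier ?Q"
    then show "c \<odot>\<^bsub>?Q\<^esub> X \<in> carrier ?Q"
      using pre f_smult f_closed cB by metis
  next
    fix c d :: 'a and X assume X: "X \<in> carrier ?Q"
    then obtain x where x: "x \<in> carrier B" "X = f x" using pre by blast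
    show "(c \<oplus>\<^bsub>class_ring\<^esub> d) \<odot>\<^bsub>?Q\<^esub> X = c \<odot>\<^bsub>?Q\<^esub> X \<oplus>\<^bsub>?Q\<^esub> d \<odot>\<^bsub>?Q\<^esub> X"
      using B.smult_l_distr[of c d x] x by (simp add: cB flip: f_smult f_add)
    show "(c \<otimes>\<^bsub>class_ring\<^esub> d) \<odot>\<^bsub>?Q\<^esub> X = c \<odot>\<^bsub>?Q\<^esub> (d \<odot>\<^bsub>?Q\<^esub> X)"
      using B.smult_assoc1[of c d x] x by (simp add: cB flip: f_smult)
    show "\<one>\<^bsub>class_ring\<^esub> \<odot>\<^bsub>?Q\<^esub> X = X"
      using B.smult_one[of x] x by (simp flip: f_smult)
  next
    fix c :: 'a and X Y assume X: "X \<in> carrier ?Q" and Y: "Y \<in> carrier ?Q"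
    then obtain x y where x: "x \<in> carrier B" "X = f x" and y: "y \<in> carrier B" "Y = f y" using pre by blast
    show "c \<odot>\<^bsub>?Q\<^esub> (X \<oplus>\<^bsub>?Q\<^esub> Y) = c \<odot>\<^bsub>?Q\<^esub> X \<oplus>\<^bsub>?Q\<^esub> c \<odot>\<^bsub>?Q\<^esub> Y"
      using B.smult_r_distr[of c x y] x y by (simp add: cB flip: f_smult f_add)
    show "(c \<odot>\<^bsub>?Q\<^esub> X) \<otimes>\<^bsub>?Q\<^esub> Y = c \<odot>\<^bsub>?Q\<^esub> (X \<otimes>\<^bsub>?Q\<^esub> Y)"
      using B.smult_assoc2[of c x y] x y by (simp add: cB flip: f_smult f_mult)
  qed
  then show ?thesis
    unfolding alg_isomorphic_def using B iso f_smult by blast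
qed

section \<open>The matrix algebras and a criterion for their presentations\<close>

lemma carrier_scalars_plus_fam:
  "carrier (scalars_plus 4 (fam a p q r)) = {elem a p q r c x y z | c x y z. True}"
proof (intro subset_antisym subsetI)
  fix M assume "M \<in> carrier (scalars_plus 4 (fam a p q r))"
  then obtain k l u where "M = k \<cdot>\<^sub>m 1\<^sub>m 4 + l \<cdot>\<^sub>m u" "u \<in> fam a p q r"
    unfolding scalars_plus_def by auto
  then show "M \<in> {elem a p q r c x y z | c x y z. True}"
    unfolding fam_def by (auto simp: elem_one[of a p q r] elem_smult elem_add)
next
  fix M assume "M \<in> {elem a p q r c x y z | c x y z. True}"
  then obtain c x y z where "M = elem a p q r c x y z" by blast
  \<comment> \<open>The group element already contributes 1 to the diagonal, hence the scalar
    \<open>c - 1\<close>.\<close>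
  then have "M = (c - 1) \<cdot>\<^sub>m 1\<^sub>m 4 + 1 \<cdot>\<^sub>m elem a p q r 1 x y z"
    unfolding elem_one[of a p q r] elem_smult elem_add by simp
  moreover have "elem a p q r 1 x y z \<in> fam a p q r" unfolding fam_def by blast
  ultimately show "M \<in> carrier (scalars_plus 4 (fam a p q r))"
    unfolding scalars_plus_def by auto
qed

lemma scalars_plus_simps:
  "mult (scalars_plus n U) = (*)" "one (scalars_plus n U) = 1\<^sub>m n" "zero (scalars_plus n U) = 0\<^sub>m n n"
  "add (scalars_plus n U) = (+)" "smult (scalars_plus n U) = (\<cdot>\<^sub>m)"
  by (simp_all add: scalars_plus_def)

lemma algebra_scalars_plus_fam:
  assumes ar: "a * r = 0"
  shows "algebra class_ring (scalars_plus 4 (fam a p q r))"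
proof -
  let ?B = "scalars_plus 4 (fam a p q r)"
  have ex: "\<exists>c x y z. M = elem a p q r c x y z" if "M \<in> carrier ?B" for M
    using that unfolding carrier_scalars_plus_fam by blast
  have el: "elem a p q r c x y z \<in> carrier ?B" for c x y z
    unfolding carrier_scalars_plus_fam by blast
  have mat: "carrier ?B \<subseteq> carrier_mat 4 4" unfolding carrier_scalars_plus_fam by auto
  have mult: "M * N \<in> carrier ?B" "M * N = N * M" if "M \<in> carrier ?B" "N \<in> carrier ?B" for M N
    using ex[OF that(1)] ex[OF that(2)] el by (auto simp: elem_mult[OF ar] algebra_simps)
  have add: "M + N \<in> carrier ?B" if "M \<in> carrier ?B" "N \<in> carrier ?B" for M N
    using ex[OF that(1)] ex[OF that(2)] el by (auto simp: elem_add)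
  have smult: "k \<cdot>\<^sub>m M \<in> carrier ?B" if "M \<in> carrier ?B" for k M
    using ex[OF that] el by (auto simp: elem_smult)
  have one: "1\<^sub>m 4 \<in> carrier ?B" unfolding elem_one[of a p q r] by (rule el)
  have zero: "0\<^sub>m 4 4 \<in> carrier ?B" unfolding elem_zero[of a p q r] by (rule el)
  have neg: "\<exists>N \<in> carrier ?B. N + M = 0\<^sub>m 4 4" if M: "M \<in> carrier ?B" for M
  proof -
    obtain c x y z where "M = elem a p q r c x y z" using ex[OF M] by blast
    then have "elem a p q r (- c) (- x) (- y) (- z) + M = 0\<^sub>m 4 4"
      by (simp add: elem_add elem_zero[of a p q r])
    then show ?thesis using el by blast
  qed
  show ?thesis
  proof (rule algebraI[OF cring_class_ring])
    show "cring ?B"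
    proof (rule cringI)
      show "abelian_group ?B"
        by (rule abelian_groupI)
          (use mat add zero neg in \<open>auto simp: scalars_plus_simps subset_iff
            assoc_add_mat[of _ 4 4] left_add_zero_mat[of _ 4 4] intro: comm_add_mat[of _ 4 4]\<close>)
      show "comm_monoid ?B"
        by (rule comm_monoidI)
          (use mat mult(1) one in \<open>auto simp: scalars_plus_simps subset_iff assoc_mult_mat[of _ 4 4 _ 4 _ 4]
            left_mult_one_mat[of _ 4 4] intro: mult(2)\<close>)
    qed (use mat in \<open>auto simp: scalars_plus_simps subset_iff add_mult_distrib_mat[of _ 4 4 _ _ 4]\<close>)
  next
    fix k and M N assume "M \<in> carrier ?B" "N \<in> carrier ?B"
    then show "(k \<odot>\<^bsub>?B\<^esub> M) \<otimes>\<^bsub>?B\<^esub> N = k \<odot>\<^bsub>?B\<^esub> (M \<otimes>\<^bsub>?B\<^esub> N)"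
      using ex[of M] ex[of N] by (auto simp: scalars_plus_simps elem_smult elem_mult[OF ar] algebra_simps)
  next
    fix k and M N assume "M \<in> carrier ?B" "N \<in> carrier ?B"
    then show "k \<odot>\<^bsub>?B\<^esub> (M \<oplus>\<^bsub>?B\<^esub> N) = k \<odot>\<^bsub>?B\<^esub> M \<oplus>\<^bsub>?B\<^esub> k \<odot>\<^bsub>?B\<^esub> N"
      using ex[of M] ex[of N] by (auto simp: scalars_plus_simps elem_smult elem_add algebra_simps)
  qed (use ex smult in \<open>auto simp: scalars_plus_simps elem_smult elem_add algebra_simps\<close>)
qed

lemma poly_mapping_sum_single:
  "p = (\<Sum>m \<in> Poly_Mapping.keys p. Poly_Mapping.single m (Poly_Mapping.lookup p m))"
  by (rule poly_mapping_eqI)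
    (auto simp: lookup_sum lookup_single when_def in_keys_iff)

text \<open>The functionals \<open>f0, \<dots>, f3\<close> are the coordinates of a homomorphism from the polynomials onto
  \<open>scalars_plus 4 (fam a p q r)\<close>; they vanish on \<open>I\<close>, and modulo \<open>I\<close> every monomial is a linear
  combination of \<open>1, b1, b2, b3\<close>, so \<open>I\<close> is exactly the kernel.\<close>

lemma alg_isomorphic_fam:
  fixes f0 f1 f2 f3 :: "'a::field mpolynomial \<Rightarrow> 'a"
  assumes ar: "a * r = 0" and I: "ideal I (poly_alg k)"
    and kills: "\<And>u. u \<in> I \<Longrightarrow> f0 u = 0 \<and> f1 u = 0 \<and> f2 u = 0 \<and> f3 u = 0"
    and add: "\<And>u v. f0 (u + v) = f0 u + f0 v" "\<And>u v. f1 (u + v) = f1 u + f1 v"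
      "\<And>u v. f2 (u + v) = f2 u + f2 v" "\<And>u v. f3 (u + v) = f3 u + f3 v"
    and scale: "\<And>c u. f0 (t_const c * u) = c * f0 u" "\<And>c u. f1 (t_const c * u) = c * f1 u"
      "\<And>c u. f2 (t_const c * u) = c * f2 u" "\<And>c u. f3 (t_const c * u) = c * f3 u"
    and one: "f0 1 = 1" "f1 1 = 0" "f2 1 = 0" "f3 1 = 0"
    and mult: "\<And>u v. f0 (u * v) = f0 u * f0 v" "\<And>u v. f1 (u * v) = f0 u * f1 v + f1 u * f0 v"
      "\<And>u v. f2 (u * v) = f0 u * f2 v + f2 u * f0 v + a * f1 u * f1 v"
      "\<And>u v. f3 (u * v) = f0 u * f3 v + f3 u * f0 v + p * f1 u * f1 v
        + q * (f1 u * f2 v + f2 u * f1 v) + r * f2 u * f2 v"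
    and b_carrier: "b1 \<in> carrier (poly_alg k)" "b2 \<in> carrier (poly_alg k)" "b3 \<in> carrier (poly_alg k)"
    and b: "f0 b1 = 0" "f1 b1 = 1" "f2 b1 = 0" "f3 b1 = 0"
      "f0 b2 = 0" "f1 b2 = 0" "f2 b2 = 1" "f3 b2 = 0"
      "f0 b3 = 0" "f1 b3 = 0" "f2 b3 = 0" "f3 b3 = 1"
    and spans: "\<And>m. Poly_Mapping.keys m \<subseteq> {1..k} \<Longrightarrow>
      Poly_Mapping.single m 1 \<in> {1, b1, b2} \<or> (\<exists>z. Poly_Mapping.single m 1 - t_const z * b3 \<in> I)"
  shows "alg_isomorphic class_ring (scalars_plus 4 (fam a p q r)) (quot_alg (poly_alg k) I)"
proof -
  interpret I: ideal I "poly_alg k" by fact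
  define comb where "comb c x y z = t_const c + t_const x * b1 + t_const y * b2 + t_const z * b3" for c x y z
  have f_const: "f0 (t_const c) = c" "f1 (t_const c) = 0" "f2 (t_const c) = 0" "f3 (t_const c) = 0" for c
    using scale[of c 1] by (simp_all add: one)
  have f_comb: "f0 (comb c x y z) = c" "f1 (comb c x y z) = x" "f2 (comb c x y z) = y" "f3 (comb c x y z) = z"
    for c x y z
    by (simp_all add: comb_def add scale f_const b)
  have comb_carrier: "comb c x y z \<in> carrier (poly_alg k)" for c x y z
    unfolding comb_def by (intro poly_alg_closed b_carrier)
  have I_add: "u + v \<in> I" if "u \<in> I" "v \<in> I" for u v 
    using additive_subgroup.a_closed[OF I.is_additive_subgroup that] by (simp add: poly_alg_simps)
  have I_mult: "u * v \<in> I" if "u \<in> carrier (poly_alg k)" "v \<in> I" for u v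
    using I.I_l_closed[OF that(2,1)] by (simp add: poly_alg_simps)
  have I_0: "0 \<in> I" using additive_subgroup.zero_closed[OF I.is_additive_subgroup] by (simp add: poly_alg_simps)
  have span_monom: "\<exists>c x y z. Poly_Mapping.single m 1 - comb c x y z \<in> I" if m: "Poly_Mapping.keys m \<subseteq> {1..k}" for m
  proof -
    have "comb 1 0 0 0 = 1" "comb 0 1 0 0 = b1" "comb 0 0 1 0 = b2" "comb 0 0 0 z = t_const z * b3" for z
      by (simp_all add: comb_def t_const_simps)
    then show ?thesis using spans[OF m] I_0 by (metis diff_self insertE singletonD)
  qed
  have span_I: "\<exists>c x y z. u - comb c x y z \<in> I" if u: "u \<in> carrier (poly_alg k)" for u
  proof -
    have "\<exists>c x y z. (\<Sum>m \<in> M. Poly_Mapping.single m (Poly_Mapping.lookup u m)) - comb c x y z \<in> I"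
      if "finite M" "M \<subseteq> Poly_Mapping.keys u" for M
      using that
    proof (induction M rule: finite_induct)
      case empty
      have "0 - comb 0 0 0 0 = 0" by (simp add: comb_def t_const_simps)
      then show ?case using I_0 by (metis sum.empty)
    next
      case (insert m M)
      let ?d = "Poly_Mapping.lookup u m" and ?s = "\<Sum>m \<in> M. Poly_Mapping.single m (Poly_Mapping.lookup u m)"
      obtain c x y z where 1: "?s - comb c x y z \<in> I" using insert by blast
      obtain c' x' y' z' where 2: "Poly_Mapping.single m 1 - comb c' x' y' z' \<in> I"
        using span_monom[of m] insert.prems u unfolding carrier_poly_alg by blast
      have "t_const ?d * (Poly_Mapping.single m 1 - comb c' x' y' z') + (?s - comb c x y z) \<in> I"
        by (intro I_add I_mult 1 2 poly_alg_closed)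
      moreover have "t_const ?d * Poly_Mapping.single m 1 = Poly_Mapping.single m ?d"
        by (simp add: t_const_def mult_single)
      then have "t_const ?d * (Poly_Mapping.single m 1 - comb c' x' y' z') + (?s - comb c x y z) =
          Poly_Mapping.single m ?d + ?s - comb (?d * c' + c) (?d * x' + x) (?d * y' + y) (?d * z' + z)"
        by (simp add: comb_def t_const_simps algebra_simps)
      ultimately have "Poly_Mapping.single m ?d + ?s - comb (?d * c' + c) (?d * x' + x) (?d * y' + y) (?d * z' + z) \<in> I"
        by (rule back_subst[of "\<lambda>u. u \<in> I"])
      then show ?case using insert.hyps by auto
    qed
    from this[OF _ subset_refl] show ?thesis using poly_mapping_sum_single[of u] by simp
  qed
  define h where "h u = elem a p q r (f0 u) (f1 u) (f2 u) (f3 u)" for u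
  show ?thesis
  proof (rule alg_isomorphic_quot_alg[where h = h])
    fix y assume "y \<in> carrier (scalars_plus 4 (fam a p q r))"
    then obtain c x1 x2 x3 where "y = elem a p q r c x1 x2 x3" unfolding carrier_scalars_plus_fam by blast
    then have "h (comb c x1 x2 x3) = y" by (simp add: h_def f_comb)
    then show "\<exists>x \<in> carrier (poly_alg k). h x = y" using comb_carrier by blast
  next
    fix u :: "'a mpolynomial" assume "u \<in> carrier (poly_alg k)"
    then obtain c x y z where u: "u - comb c x y z \<in> I" using span_I by blast
    \<comment> \<open>The coordinates vanish on \<open>u - comb c x y z\<close>, so those of
      \<open>u\<close> are \<open>c, x, y, z\<close>. If all are 0 then the combination is 0 and
      \<open>u\<close> itself lies in \<open>I\<close>.\<close>
    have "f0 u = c" "f1 u = x" "f2 u = y" "f3 u = z"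
      using kills[OF u] add(1)[of "u - comb c x y z" "comb c x y z"] add(2)[of "u - comb c x y z" "comb c x y z"]
        add(3)[of "u - comb c x y z" "comb c x y z"] add(4)[of "u - comb c x y z" "comb c x y z"]
      by (simp_all add: f_comb)
    moreover have "comb 0 0 0 0 = 0" by (simp add: comb_def t_const_simps)
    ultimately show "h u = \<zero>\<^bsub>scalars_plus 4 (fam a p q r)\<^esub> \<longleftrightarrow> u \<in> I"
      using u kills[of u] by (auto simp: h_def scalars_plus_simps elem_zero[of a p q r])
  qed (use I ar in \<open>auto simp: h_def algebra_poly_alg algebra_scalars_plus_fam scalars_plus_simps poly_alg_simps
      carrier_scalars_plus_fam elem_add elem_mult elem_smult elem_one[of a p q r] add mult one f_const algebra_simps\<close>)
qed

text \<open>The common zeros form an ideal, because every term of the multiplication rules contains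
  a coordinate of each factor. Vanishing therefore needs checking on generators only.\<close>

lemma Idl_coords_zero:
  fixes f0 f1 f2 f3 :: "'a::field mpolynomial \<Rightarrow> 'a"
  assumes S: "S \<subseteq> carrier (poly_alg k)" "\<And>u. u \<in> S \<Longrightarrow> f0 u = 0 \<and> f1 u = 0 \<and> f2 u = 0 \<and> f3 u = 0"
    and add: "\<And>u v. f0 (u + v) = f0 u + f0 v" "\<And>u v. f1 (u + v) = f1 u + f1 v"
      "\<And>u v. f2 (u + v) = f2 u + f2 v" "\<And>u v. f3 (u + v) = f3 u + f3 v"
    and mult: "\<And>u v. f0 (u * v) = f0 u * f0 v" "\<And>u v. f1 (u * v) = f0 u * f1 v + f1 u * f0 v"
      "\<And>u v. f2 (u * v) = f0 u * f2 v + f2 u * f0 v + a * f1 u * f1 v"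
      "\<And>u v. f3 (u * v) = f0 u * f3 v + f3 u * f0 v + p * f1 u * f1 v
        + q * (f1 u * f2 v + f2 u * f1 v) + r * f2 u * f2 v"
    and u: "u \<in> Idl\<^bsub>poly_alg k\<^esub> S"
  shows "f0 u = 0 \<and> f1 u = 0 \<and> f2 u = 0 \<and> f3 u = 0"
proof -
  interpret A: cring "poly_alg k :: ('a, 'a mpolynomial) module"
    by (rule algebra.M_cring[OF algebra_poly_alg])
  let ?K = "{u \<in> carrier (poly_alg k). f0 u = 0 \<and> f1 u = 0 \<and> f2 u = 0 \<and> f3 u = 0}"
  have "f 0 = 0" if "\<And>u v. f (u + v) = f u + f v" for f :: "'a mpolynomial \<Rightarrow> 'a"
    using that[of 0 0] by (metis add.right_neutral add_cancel_right_right)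
  then have zero: "f0 0 = 0" "f1 0 = 0" "f2 0 = 0" "f3 0 = 0" using add by blast+
  have neg: "f0 (- u) = - f0 u" "f1 (- u) = - f1 u" "f2 (- u) = - f2 u" "f3 (- u) = - f3 u" for u
    using add(1)[of u "- u"] add(2)[of u "- u"] add(3)[of u "- u"] add(4)[of u "- u"] zero
    by (simp_all add: eq_neg_iff_add_eq_0 add.commute)
  have inv: "\<ominus>\<^bsub>poly_alg k\<^esub> u = - u" if "u \<in> carrier (poly_alg k)" for u :: "'a mpolynomial"
    using that by (intro A.minus_equality) (auto simp: poly_alg_simps poly_alg_closed)
  have "ideal ?K (poly_alg k)"
  proof (rule idealI[OF A.ring_axioms])
    show "subgroup ?K (add_monoid (poly_alg k))"
      by (rule A.add.subgroupI) (use inv in \<open>auto simp: poly_alg_simps poly_alg_closed add neg zero intro: exI[of _ 0]\<close>)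
  qed (auto simp: poly_alg_simps poly_alg_closed mult)
  then have "Idl\<^bsub>poly_alg k\<^esub> S \<subseteq> ?K" using S by (intro A.genideal_minimal) auto
  with u show ?thesis by blast
qed

section \<open>The five presentations\<close>

lemma t_var_power: "t_var i ^ n = Poly_Mapping.single (monom_pow i n) 1"
  by (induction n) (simp_all add: t_var_def mult_single flip: single_add)

lemma monomial_1_var:
  assumes "Poly_Mapping.keys m \<subseteq> {1..1}"
  shows "\<exists>n. Poly_Mapping.single m 1 = t_var 1 ^ n"
proof -
  have "m = monom_pow 1 (Poly_Mapping.lookup m 1)"
  proof (rule poly_mapping_eqI)
    fix i
    have "i \<in> Poly_Mapping.keys m \<Longrightarrow> i = 1" using assms by force
    then show "Poly_Mapping.lookup m i = Poly_Mapping.lookup (monom_pow 1 (Poly_Mapping.lookup m 1)) i"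
      by (auto simp: lookup_single when_def in_keys_iff)
  qed
  then show ?thesis unfolding t_var_power by metis
qed

lemma monomial_2_vars:
  assumes "Poly_Mapping.keys m \<subseteq> {1..2}"
  shows "\<exists>i j. Poly_Mapping.single m 1 = t_var 1 ^ i * t_var 2 ^ j"
proof -
  have "m = monom_pow 1 (Poly_Mapping.lookup m 1) + monom_pow 2 (Poly_Mapping.lookup m 2)"
  proof (rule poly_mapping_eqI)
    fix i
    have "i \<in> Poly_Mapping.keys m \<Longrightarrow> i = 1 \<or> i = 2" using assms by force
    then show "Poly_Mapping.lookup m i =
        Poly_Mapping.lookup (monom_pow 1 (Poly_Mapping.lookup m 1) + monom_pow 2 (Poly_Mapping.lookup m 2)) i"
      by (auto simp: lookup_add lookup_single when_def in_keys_iff)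
  qed
  then show ?thesis unfolding t_var_power mult_single by (metis mult_1)
qed

lemma n12: "Suc 0 \<noteq> 2" and n13: "Suc 0 \<noteq> 3" by simp_all

lemma coeff2_const:
  assumes "u \<noteq> v"
  shows "coeff2 u v (t_const c) i j = (if i = 0 \<and> j = 0 then c else 0)"
  using coeff2_scale[of u v c 1 i j] by (simp add: coeff2_one[OF assms])

lemmas coeff12 = coeff2_mult_low[OF n12] coeff2_one[OF n12] coeff2_var[OF n12] coeff2_const[OF n12]
  coeff2_add coeff2_diff coeff2_scale

lemma power4_eq: "x ^ 4 = x * x * x * (x :: 'a::monoid_mult)"
  by (simp add: eval_nat_numeral mult.assoc)

lemma power_split: "k \<le> n \<Longrightarrow> x ^ n = x ^ k * (x :: 'a::monoid_mult) ^ (n - k)"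
  by (metis le_add_diff_inverse power_add)

lemma ideal_poly_alg_mult:
  assumes "ideal I (poly_alg k)" "u \<in> I" "v \<in> carrier (poly_alg k)"
  shows "u * v \<in> I" "v * u \<in> I"
  using ideal.I_r_closed[OF assms] ideal.I_l_closed[OF assms] by (simp_all add: poly_alg_simps)

lemma ideal_poly_alg_add:
  assumes "ideal I (poly_alg k)" "u \<in> I" "v \<in> I"
  shows "u + v \<in> I"
  using additive_subgroup.a_closed[OF ideal.axioms(1)[OF assms(1)] assms(2,3)] by (simp add: poly_alg_simps)

lemma ideal_poly_alg_0: "ideal I (poly_alg k) \<Longrightarrow> 0 \<in> I"
  using additive_subgroup.zero_closed[OF ideal.axioms(1)] by (force simp: poly_alg_simps)

lemma ideal_Idl_poly_alg: "S \<subseteq> carrier (poly_alg k) \<Longrightarrow> ideal (Idl\<^bsub>poly_alg k\<^esub> S) (poly_alg k)"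
  and Idl_poly_alg_self: "S \<subseteq> carrier (poly_alg k) \<Longrightarrow> u \<in> S \<Longrightarrow> u \<in> Idl\<^bsub>poly_alg k\<^esub> S"
  for S :: "'a::field mpolynomial set"
proof -
  interpret A: algebra class_ring "poly_alg k :: ('a, 'a mpolynomial) module" by (rule algebra_poly_alg)
  show "ideal (Idl\<^bsub>poly_alg k\<^esub> S) (poly_alg k)" if "S \<subseteq> carrier (poly_alg k)"
    using that by (rule A.genideal_ideal)
  show "u \<in> Idl\<^bsub>poly_alg k\<^esub> S" if "S \<subseteq> carrier (poly_alg k)" "u \<in> S"
    using A.genideal_self[OF that(1)] that(2) by blast
qed

lemmas poly_alg_intros = poly_alg_closed poly_alg_diff poly_alg_power

text \<open>The coordinates are the coefficients of the powers of \<open>t\<close> up to the third.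
  The second index of \<open>?c\<close> belongs to a dummy variable with exponent 0
  throughout.\<close>

lemma algebra_S_4: "alg_isomorphic class_ring (scalars_plus 4 (S_4 :: 'a::field mat set)) (poly_quot 1 {t_var 1 ^ 4})"
proof -
  let ?t = "t_var (Suc 0) :: 'a mpolynomial"
  let ?A = "poly_alg (Suc 0) :: ('a, 'a mpolynomial) module"
  let ?I = "Idl\<^bsub>?A\<^esub> {?t ^ 4}"
  let ?c = "coeff2 (Suc 0) 2 :: 'a mpolynomial \<Rightarrow> nat \<Rightarrow> nat \<Rightarrow> 'a"
  have t: "?t \<in> carrier ?A" by (intro poly_alg_intros) simp
  have S: "{?t ^ 4} \<subseteq> carrier ?A" using t by (simp add: poly_alg_intros)
  note I = ideal_Idl_poly_alg[OF S]
  have gen: "?t ^ 4 \<in> ?I" by (rule Idl_poly_alg_self[OF S]) simp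
  show ?thesis
    unfolding fam_instances poly_quot_def One_nat_def
  proof (rule alg_isomorphic_fam[where ?b1.0 = ?t and ?b2.0 = "?t ^ 2" and ?b3.0 = "?t ^ 3" and
        ?f0.0 = "\<lambda>u. ?c u 0 0" and ?f1.0 = "\<lambda>u. ?c u (Suc 0) 0" and ?f2.0 = "\<lambda>u. ?c u 2 0" and ?f3.0 = "\<lambda>u. ?c u 3 0", OF _ I])
    fix u assume "u \<in> ?I"
    then show "?c u 0 0 = 0 \<and> ?c u (Suc 0) 0 = 0 \<and> ?c u 2 0 = 0 \<and> ?c u 3 0 = 0"
      by (rule Idl_coords_zero[OF S, where a = 1 and p = 0 and q = 1 and r = 0, rotated -1])
        (auto simp: power4_eq coeff12 algebra_simps)
  next
    fix m :: "nat \<Rightarrow>\<^sub>0 nat" assume "Poly_Mapping.keys m \<subseteq> {1..Suc 0}"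
    then obtain n where n: "Poly_Mapping.single m 1 = ?t ^ n" using monomial_1_var[of m] unfolding One_nat_def by blast
    consider "n = 0" | "n = 1" | "n = 2" | "n = 3" | "n = 4 + (n - 4)" by linarith
    then show "Poly_Mapping.single m 1 \<in> {1, ?t, ?t ^ 2} \<or> (\<exists>z. Poly_Mapping.single m 1 - t_const z * ?t ^ 3 \<in> ?I)"
    proof cases
      case 4
      then have "Poly_Mapping.single m 1 - t_const 1 * ?t ^ 3 = 0" by (simp add: n t_const_simps)
      then show ?thesis using ideal_poly_alg_0[OF I] by metis
    next
      case 5
      then have "Poly_Mapping.single m 1 - t_const 0 * ?t ^ 3 = ?t ^ 4 * ?t ^ (n - 4)"
        by (metis n t_const_simps(4) diff_zero mult_zero_left power_add)
      then show ?thesis using ideal_poly_alg_mult(1)[OF I gen poly_alg_power[OF t]] by metis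
    qed (simp_all add: n)
  qed (use t in \<open>simp_all add: poly_alg_intros coeff12 power2_eq_square power3_eq_cube algebra_simps\<close>)
qed

text \<open>Here the square of the first basis vector is the second, so the second variable must
  take the third place in the basis.\<close>

lemma algebra_S_31: "alg_isomorphic class_ring (scalars_plus 4 (S_31 :: 'a::field mat set))
    (poly_quot 2 {t_var 1 ^ 3, t_var 2 ^ 2, t_var 1 * t_var 2})"
proof -
  let ?s = "t_var (Suc 0) :: 'a mpolynomial" and ?t = "t_var 2 :: 'a mpolynomial"
  let ?A = "poly_alg 2 :: ('a, 'a mpolynomial) module"
  let ?S = "{?s ^ 3, ?t ^ 2, ?s * ?t}"
  let ?I = "Idl\<^bsub>?A\<^esub> ?S"
  let ?c = "coeff2 (Suc 0) 2 :: 'a mpolynomial \<Rightarrow> nat \<Rightarrow> nat \<Rightarrow> 'a"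
  have st: "?s \<in> carrier ?A" "?t \<in> carrier ?A" by (intro poly_alg_intros; simp)+
  have S: "?S \<subseteq> carrier ?A" using st by (simp add: poly_alg_intros)
  note I = ideal_Idl_poly_alg[OF S]
  have gen: "?s ^ 3 \<in> ?I" "?t ^ 2 \<in> ?I" "?s * ?t \<in> ?I" by (rule Idl_poly_alg_self[OF S]; simp)+
  have monom_carrier: "?s ^ i * ?t ^ j \<in> carrier ?A" for i j by (intro poly_alg_closed(2) poly_alg_power st)
  show ?thesis
    unfolding fam_instances poly_quot_def One_nat_def
  proof (rule alg_isomorphic_fam[where ?b1.0 = ?s and ?b2.0 = "?s ^ 2" and ?b3.0 = "?t" and
        ?f0.0 = "\<lambda>u. ?c u 0 0" and ?f1.0 = "\<lambda>u. ?c u (Suc 0) 0" and ?f2.0 = "\<lambda>u. ?c u 2 0"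
        and ?f3.0 = "\<lambda>u. ?c u 0 (Suc 0)", OF _ I])
    fix u assume "u \<in> ?I"
    then show "?c u 0 0 = 0 \<and> ?c u (Suc 0) 0 = 0 \<and> ?c u 2 0 = 0 \<and> ?c u 0 (Suc 0) = 0"
      by (rule Idl_coords_zero[OF S, where a = 1 and p = 0 and q = 0 and r = 0, rotated -1])
        (auto simp: power2_eq_square power3_eq_cube coeff12 algebra_simps)
  next
    fix m :: "nat \<Rightarrow>\<^sub>0 nat" assume "Poly_Mapping.keys m \<subseteq> {1..2}"
    then obtain i j where m: "Poly_Mapping.single m 1 = ?s ^ i * ?t ^ j" using monomial_2_vars[of m] unfolding One_nat_def by blast
    have "i = 0 \<and> j = 0 \<or> i = 1 \<and> j = 0 \<or> i = 2 \<and> j = 0 \<or> i = 0 \<and> j = 1 \<or>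
        3 \<le> i \<or> 2 \<le> j \<or> 1 \<le> i \<and> 1 \<le> j" by linarith
    moreover have "Poly_Mapping.single m 1 - t_const 0 * ?t \<in> ?I" if "3 \<le> i \<or> 2 \<le> j \<or> 1 \<le> i \<and> 1 \<le> j"
    proof -
      have "?s ^ i * ?t ^ j \<in> ?I"
        using that
      proof (elim disjE conjE)
        assume "3 \<le> i"
        then have "?s ^ i * ?t ^ j = ?s ^ 3 * (?s ^ (i - 3) * ?t ^ j)"
          by (metis power_split mult.assoc)
        then show ?thesis using ideal_poly_alg_mult(1)[OF I gen(1) monom_carrier] by metis
      next
        assume "2 \<le> j"
        then have "?s ^ i * ?t ^ j = ?t ^ 2 * (?s ^ i * ?t ^ (j - 2))"
          by (metis power_split mult.left_commute)
        then show ?thesis using ideal_poly_alg_mult(1)[OF I gen(2) monom_carrier] by metis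
      next
        assume "1 \<le> i" "1 \<le> j"
        then have "?s ^ i * ?t ^ j = (?s * ?t) * (?s ^ (i - 1) * ?t ^ (j - 1))"
          by (cases i; cases j) (simp_all add: mult_ac)
        then show ?thesis using ideal_poly_alg_mult(1)[OF I gen(3) monom_carrier] by metis
      qed
      then show ?thesis by (simp add: m t_const_simps)
    qed
    moreover have "Poly_Mapping.single m 1 - t_const 1 * ?t \<in> ?I" if "i = 0" "j = 1"
      using that ideal_poly_alg_0[OF I] by (simp add: m t_const_simps)
    ultimately show "Poly_Mapping.single m 1 \<in> {1, ?s, ?s ^ 2} \<or> (\<exists>z. Poly_Mapping.single m 1 - t_const z * ?t \<in> ?I)"
      by (elim disjE) (auto simp: m)
  qed (use st in \<open>simp_all add: poly_alg_intros coeff12 power2_eq_square power3_eq_cube algebra_simps\<close>)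
qed

text \<open>The variables change places: in \<open>fam 0 1 0 l\<close> the second basis vector has
  \<open>l\<close> times the square of the first, while the ideal sets \<open>t_1^2\<close> equal to
  \<open>l t_2^2\<close>. This also explains the weight \<open>l\<close> in the last
  coordinate.\<close>

lemma algebra_R_sub:
  assumes l: "l \<noteq> (0::'a::field)"
  shows "alg_isomorphic class_ring (scalars_plus 4 (R_sub l))
    (poly_quot 2 {t_var 1 ^ 2 - t_const l * t_var 2 ^ 2, t_var 1 * t_var 2})"
proof -
  let ?s = "t_var (Suc 0) :: 'a mpolynomial" and ?t = "t_var 2 :: 'a mpolynomial"
  let ?A = "poly_alg 2 :: ('a, 'a mpolynomial) module"
  let ?S = "{?s ^ 2 - t_const l * ?t ^ 2, ?s * ?t}"
  let ?I = "Idl\<^bsub>?A\<^esub> ?S"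
  let ?c = "coeff2 (Suc 0) 2 :: 'a mpolynomial \<Rightarrow> nat \<Rightarrow> nat \<Rightarrow> 'a"
  have st: "?s \<in> carrier ?A" "?t \<in> carrier ?A" by (intro poly_alg_intros; simp)+
  have S: "?S \<subseteq> carrier ?A" using st by (simp add: poly_alg_intros)
  note I = ideal_Idl_poly_alg[OF S]
  have gen: "?s ^ 2 - t_const l * ?t ^ 2 \<in> ?I" "?s * ?t \<in> ?I" by (rule Idl_poly_alg_self[OF S]; simp)+
  have monom_carrier: "?s ^ i * ?t ^ j \<in> carrier ?A" for i j by (intro poly_alg_closed(2) poly_alg_power st)
  \<comment> \<open>Combinations of the generators in which the mixed terms cancel: this one equals
    the cube of \<open>?s\<close>, the next one, which divides by \<open>l\<close>, the cube of
    \<open>?t\<close>. All monomials of degree 3 or more then lie in the ideal.\<close>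
  have "(?s ^ 2 - t_const l * ?t ^ 2) * ?s + (?s * ?t) * (t_const l * ?t) \<in> ?I"
    by (intro ideal_poly_alg_add[OF I] ideal_poly_alg_mult(1)[OF I] gen st poly_alg_closed(2,6))
  then have cube_s: "?s ^ 3 \<in> ?I" by (simp add: power2_eq_square power3_eq_cube algebra_simps)
  have "(?s ^ 2 - t_const l * ?t ^ 2) * (t_const (- inverse l) * ?t) + (?s * ?t) * (t_const (inverse l) * ?s) \<in> ?I"
    by (intro ideal_poly_alg_add[OF I] ideal_poly_alg_mult(1)[OF I] gen st poly_alg_closed(2,6))
  moreover have "t_const l * (t_const (inverse l) * u) = u" for u
    using l by (metis mult.assoc mult_1 right_inverse t_const_simps(2,3))
  ultimately have cube_t: "?t ^ 3 \<in> ?I"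
    by (simp add: power2_eq_square power3_eq_cube algebra_simps t_const_simps)
  show ?thesis
    unfolding fam_instances poly_quot_def One_nat_def
  proof (rule alg_isomorphic_fam[where ?b1.0 = ?t and ?b2.0 = "?s" and ?b3.0 = "?t ^ 2" and
        ?f0.0 = "\<lambda>u. ?c u 0 0" and ?f1.0 = "\<lambda>u. ?c u 0 (Suc 0)" and ?f2.0 = "\<lambda>u. ?c u (Suc 0) 0"
        and ?f3.0 = "\<lambda>u. ?c u 0 2 + l * ?c u 2 0", OF _ I])
    have gens: "?c u 0 0 = 0 \<and> ?c u 0 (Suc 0) = 0 \<and> ?c u (Suc 0) 0 = 0 \<and> ?c u 0 2 + l * ?c u 2 0 = 0"
      if "u \<in> ?S" for u
      using that by (auto simp: power2_eq_square coeff12)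
    fix u assume "u \<in> ?I"
    then show "?c u 0 0 = 0 \<and> ?c u 0 (Suc 0) = 0 \<and> ?c u (Suc 0) 0 = 0 \<and> ?c u 0 2 + l * ?c u 2 0 = 0"
      by (rule Idl_coords_zero[OF S gens, where a = 0 and p = 1 and q = 0 and r = l, rotated -1])
        (simp_all add: coeff12 algebra_simps)
  next
    fix m :: "nat \<Rightarrow>\<^sub>0 nat" assume "Poly_Mapping.keys m \<subseteq> {1..2}"
    then obtain i j where m: "Poly_Mapping.single m 1 = ?s ^ i * ?t ^ j" using monomial_2_vars[of m] unfolding One_nat_def by blast
    have "i = 0 \<and> j = 0 \<or> i = 0 \<and> j = 1 \<or> i = 1 \<and> j = 0 \<or> i = 0 \<and> j = 2 \<or> i = 2 \<and> j = 0 \<or>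
        3 \<le> i \<or> 3 \<le> j \<or> 1 \<le> i \<and> 1 \<le> j" by linarith
    moreover have "Poly_Mapping.single m 1 - t_const 0 * ?t ^ 2 \<in> ?I" if "3 \<le> i \<or> 3 \<le> j \<or> 1 \<le> i \<and> 1 \<le> j"
    proof -
      have "?s ^ i * ?t ^ j \<in> ?I"
        using that
      proof (elim disjE conjE)
        assume "3 \<le> i"
        then have "?s ^ i * ?t ^ j = ?s ^ 3 * (?s ^ (i - 3) * ?t ^ j)"
          by (metis power_split mult.assoc)
        then show ?thesis using ideal_poly_alg_mult(1)[OF I cube_s monom_carrier] by metis
      next
        assume "3 \<le> j"
        then have "?s ^ i * ?t ^ j = ?t ^ 3 * (?s ^ i * ?t ^ (j - 3))"
          by (metis power_split mult.left_commute)
        then show ?thesis using ideal_poly_alg_mult(1)[OF I cube_t monom_carrier] by metis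
      next
        assume "1 \<le> i" "1 \<le> j"
        then have "?s ^ i * ?t ^ j = (?s * ?t) * (?s ^ (i - 1) * ?t ^ (j - 1))"
          by (cases i; cases j) (simp_all add: mult_ac)
        then show ?thesis using ideal_poly_alg_mult(1)[OF I gen(2) monom_carrier] by metis
      qed
      then show ?thesis by (simp add: m t_const_simps)
    qed
    moreover have "Poly_Mapping.single m 1 - t_const 1 * ?t ^ 2 \<in> ?I" if "i = 0" "j = 2"
      using that ideal_poly_alg_0[OF I] by (simp add: m t_const_simps)
    moreover have "Poly_Mapping.single m 1 - t_const l * ?t ^ 2 \<in> ?I" if "i = 2" "j = 0"
      using that gen by (simp add: m)
    ultimately show "Poly_Mapping.single m 1 \<in> {1, ?t, ?s} \<or> (\<exists>z. Poly_Mapping.single m 1 - t_const z * ?t ^ 2 \<in> ?I)"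
      by (elim disjE) (auto simp: m)
  qed (use st in \<open>simp_all add: poly_alg_intros coeff12 power2_eq_square algebra_simps\<close>)
qed

lemma algebra_U_13: "alg_isomorphic class_ring (scalars_plus 4 (U_13 :: 'a::field mat set))
    (poly_quot 2 {t_var 1 ^ 2, t_var 2 ^ 2})"
proof -
  let ?s = "t_var (Suc 0) :: 'a mpolynomial" and ?t = "t_var 2 :: 'a mpolynomial"
  let ?A = "poly_alg 2 :: ('a, 'a mpolynomial) module"
  let ?S = "{?s ^ 2, ?t ^ 2}"
  let ?I = "Idl\<^bsub>?A\<^esub> ?S"
  let ?c = "coeff2 (Suc 0) 2 :: 'a mpolynomial \<Rightarrow> nat \<Rightarrow> nat \<Rightarrow> 'a"
  have st: "?s \<in> carrier ?A" "?t \<in> carrier ?A" by (intro poly_alg_intros; simp)+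
  have S: "?S \<subseteq> carrier ?A" using st by (simp add: poly_alg_intros)
  note I = ideal_Idl_poly_alg[OF S]
  have gen: "?s ^ 2 \<in> ?I" "?t ^ 2 \<in> ?I" by (rule Idl_poly_alg_self[OF S]; simp)+
  have monom_carrier: "?s ^ i * ?t ^ j \<in> carrier ?A" for i j by (intro poly_alg_closed(2) poly_alg_power st)
  show ?thesis
    unfolding fam_instances poly_quot_def One_nat_def
  proof (rule alg_isomorphic_fam[where ?b1.0 = ?s and ?b2.0 = "?t" and ?b3.0 = "?s * ?t" and
        ?f0.0 = "\<lambda>u. ?c u 0 0" and ?f1.0 = "\<lambda>u. ?c u (Suc 0) 0" and ?f2.0 = "\<lambda>u. ?c u 0 (Suc 0)"
        and ?f3.0 = "\<lambda>u. ?c u (Suc 0) (Suc 0)", OF _ I])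
    fix u assume "u \<in> ?I"
    then show "?c u 0 0 = 0 \<and> ?c u (Suc 0) 0 = 0 \<and> ?c u 0 (Suc 0) = 0 \<and> ?c u (Suc 0) (Suc 0) = 0"
      by (rule Idl_coords_zero[OF S, where a = 0 and p = 0 and q = 1 and r = 0, rotated -1])
        (auto simp: power2_eq_square coeff12 algebra_simps)
  next
    fix m :: "nat \<Rightarrow>\<^sub>0 nat" assume "Poly_Mapping.keys m \<subseteq> {1..2}"
    then obtain i j where m: "Poly_Mapping.single m 1 = ?s ^ i * ?t ^ j" using monomial_2_vars[of m] unfolding One_nat_def by blast
    have "i = 0 \<and> j = 0 \<or> i = 1 \<and> j = 0 \<or> i = 0 \<and> j = 1 \<or> i = 1 \<and> j = 1 \<or> 2 \<le> i \<or> 2 \<le> j" by linarith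
    moreover have "Poly_Mapping.single m 1 - t_const 0 * (?s * ?t) \<in> ?I" if "2 \<le> i \<or> 2 \<le> j"
    proof -
      have "?s ^ i * ?t ^ j \<in> ?I"
        using that
      proof (elim disjE)
        assume "2 \<le> i"
        then have "?s ^ i * ?t ^ j = ?s ^ 2 * (?s ^ (i - 2) * ?t ^ j)"
          by (metis power_split mult.assoc)
        then show ?thesis using ideal_poly_alg_mult(1)[OF I gen(1) monom_carrier] by metis
      next
        assume "2 \<le> j"
        then have "?s ^ i * ?t ^ j = ?t ^ 2 * (?s ^ i * ?t ^ (j - 2))"
          by (metis power_split mult.left_commute)
        then show ?thesis using ideal_poly_alg_mult(1)[OF I gen(2) monom_carrier] by metis
      qed
      then show ?thesis by (simp add: m t_const_simps)
    qed
    moreover have "Poly_Mapping.single m 1 - t_const 1 * (?s * ?t) \<in> ?I" if "i = 1" "j = 1"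
      using that ideal_poly_alg_0[OF I] by (simp add: m t_const_simps)
    ultimately show "Poly_Mapping.single m 1 \<in> {1, ?s, ?t} \<or> (\<exists>z. Poly_Mapping.single m 1 - t_const z * (?s * ?t) \<in> ?I)"
      by (elim disjE) (auto simp: m)
  qed (use st in \<open>simp_all add: poly_alg_intros coeff12 algebra_simps\<close>)
qed

text \<open>Applied twice, it splits a monomial of degree at least 2 into two factors from the ideal
  of the variables.\<close>

lemma keys_imp_monomial_factor:
  assumes "i \<in> Poly_Mapping.keys m"
  shows "\<exists>m'. m = monom_pow i 1 + m' \<and> Poly_Mapping.keys m' \<subseteq> Poly_Mapping.keys m"
proof -
  have "m = monom_pow i 1 + (m - monom_pow i 1)"
    using assms by (intro poly_mapping_eqI) (auto simp: lookup_add lookup_minus lookup_single when_def in_keys_iff)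
  moreover have "Poly_Mapping.keys (m - monom_pow i 1) \<subseteq> Poly_Mapping.keys m"
    by (auto simp: in_keys_iff lookup_minus)
  ultimately show ?thesis by blast
qed

text \<open>The ideal is a product of ideals, so vanishing of the coordinates goes by induction over
  its construction: a product of two polynomials without constant term has no linear part
  either.\<close>

lemma algebra_S_211: "alg_isomorphic class_ring (scalars_plus 4 (S_211 :: 'a::field mat set))
    (let A = poly_alg 3; J = Idl\<^bsub>A\<^esub> {t_var 1, t_var 2, t_var 3} in quot_alg A (J \<cdot>\<^bsub>A\<^esub> J))"
proof -
  let ?A = "poly_alg 3 :: ('a, 'a mpolynomial) module"
  let ?S = "{t_var (Suc 0), t_var 2, t_var 3} :: 'a mpolynomial set"
  define J where "J = Idl\<^bsub>?A\<^esub> ?S"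
  let ?I = "J \<cdot>\<^bsub>?A\<^esub> J"
  let ?c = "coeff2 (Suc 0) 2 :: 'a mpolynomial \<Rightarrow> nat \<Rightarrow> nat \<Rightarrow> 'a"
  let ?d = "coeff2 (Suc 0) 3 :: 'a mpolynomial \<Rightarrow> nat \<Rightarrow> nat \<Rightarrow> 'a"
  interpret A: algebra class_ring ?A by (rule algebra_poly_alg)
  have var: "i \<in> {1..3} \<Longrightarrow> t_var i \<in> carrier ?A" for i by (intro poly_alg_intros)
  have S: "?S \<subseteq> carrier ?A" using var by simp
  have J: "ideal J ?A" unfolding J_def by (rule ideal_Idl_poly_alg[OF S])
  have I: "ideal ?I ?A" by (rule A.ideal_prod_is_ideal[OF J J])
  have varJ: "t_var i \<in> J" if "i \<in> {1..3}" for i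
  proof -
    have "i = Suc 0 \<or> i = 2 \<or> i = 3" using that by auto
    then show ?thesis unfolding J_def by (intro Idl_poly_alg_self[OF S]) auto
  qed
  \<comment> \<open>The linear coefficient of the third variable is read off through
    \<open>?d\<close>; its product rule mentions the constant term, which has to be the same
    functional as for \<open>?c\<close>.\<close>
  have d: "?d u 0 0 = ?c u 0 0" for u by (simp add: coeff2_def)
  note coeff13 = coeff2_mult_low[OF n13] coeff2_one[OF n13] coeff2_var[OF n13] coeff2_const[OF n13]
  have J_const: "?c u 0 0 = 0" if "u \<in> J" for u
    using that unfolding J_def
    by (rule Idl_coords_zero[OF S, where ?f0.0 = "\<lambda>u. ?c u 0 0" and ?f1.0 = "\<lambda>_. 0" and ?f2.0 = "\<lambda>_. 0"
          and ?f3.0 = "\<lambda>_. 0" and a = 0 and p = 0 and q = 0 and r = 0, THEN conjunct1, rotated -1])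
      (auto simp: coeff12)
  have main: "alg_isomorphic class_ring (scalars_plus 4 (fam 0 0 0 0)) (quot_alg ?A ?I)"
  proof (rule alg_isomorphic_fam[where ?b1.0 = "t_var (Suc 0)" and ?b2.0 = "t_var 2" and ?b3.0 = "t_var 3" and
        ?f0.0 = "\<lambda>u. ?c u 0 0" and ?f1.0 = "\<lambda>u. ?c u (Suc 0) 0" and ?f2.0 = "\<lambda>u. ?c u 0 (Suc 0)"
        and ?f3.0 = "\<lambda>u. ?d u 0 (Suc 0)", OF _ I])
    fix u assume "u \<in> ?I"
    then show "?c u 0 0 = 0 \<and> ?c u (Suc 0) 0 = 0 \<and> ?c u 0 (Suc 0) = 0 \<and> ?d u 0 (Suc 0) = 0"
      by (induction u rule: ideal_prod.induct)
        (auto simp: poly_alg_simps coeff12 coeff13 coeff2_add d J_const)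
  next
    fix m :: "nat \<Rightarrow>\<^sub>0 nat" assume m: "Poly_Mapping.keys m \<subseteq> {1..3}"
    consider "m = 0" | i where "i \<in> Poly_Mapping.keys m" by (metis ex_in_conv keys_eq_empty)
    then show "Poly_Mapping.single m 1 \<in> {1, t_var (Suc 0), t_var 2} \<or>
        (\<exists>z. Poly_Mapping.single m 1 - t_const z * t_var 3 \<in> ?I)"
    proof cases
      case 1
      then show ?thesis by simp
    next
      case 2
      then obtain m' where m': "m = monom_pow i 1 + m'" "Poly_Mapping.keys m' \<subseteq> Poly_Mapping.keys m"
        using keys_imp_monomial_factor by blast
      have i: "i \<in> {1..3}" using 2 m by blast
      have factor: "Poly_Mapping.single m 1 = t_var i * Poly_Mapping.single m' 1"
        by (simp add: m'(1) t_var_def mult_single)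
      consider "m' = 0" | j where "j \<in> Poly_Mapping.keys m'" by (metis ex_in_conv keys_eq_empty)
      then show ?thesis
      proof cases
        case 1
        then have eq: "Poly_Mapping.single m 1 = t_var i" using factor by simp
        have "Poly_Mapping.single m 1 - t_const 1 * t_var 3 \<in> ?I" if "i = 3"
          using ideal_poly_alg_0[OF I] by (simp add: eq that t_const_simps)
        moreover have "i = Suc 0 \<or> i = 2 \<or> i = 3" using i by auto
        ultimately show ?thesis using eq by blast
      next
        case 2
        then obtain m'' where m'': "m' = monom_pow j 1 + m''" "Poly_Mapping.keys m'' \<subseteq> Poly_Mapping.keys m'"
          using keys_imp_monomial_factor by blast
        have j: "j \<in> {1..3}" using 2 m m' by blast
        have factor': "Poly_Mapping.single m' 1 = t_var j * Poly_Mapping.single m'' 1"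
          by (simp add: m''(1) t_var_def mult_single)
        have "Poly_Mapping.single m'' 1 \<in> carrier ?A"
          using m m' m'' unfolding carrier_poly_alg by auto
        then have "Poly_Mapping.single m' 1 \<in> J"
          unfolding factor' by (rule ideal_poly_alg_mult(1)[OF J varJ[OF j]])
        then have "Poly_Mapping.single m 1 \<in> ?I"
          unfolding factor using ideal_prod.prod[OF varJ[OF i], of _ J ?A] by (simp add: poly_alg_simps)
        then have "Poly_Mapping.single m 1 - t_const 0 * t_var 3 \<in> ?I" by (simp add: t_const_simps)
        then show ?thesis by blast
      qed
    qed
  qed (use var in \<open>simp_all add: coeff12 coeff13 coeff2_add coeff2_scale d algebra_simps\<close>)
  then show ?thesis unfolding fam_instances Let_def J_def One_nat_def .
qed

theorem mainTheorem3:
  fixes Fsq :: "'a::field set"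
  assumes "is_transversal field_units unit_squares Fsq"
  shows
    "is_complete_set_of_reps (conj_in (AGL 3)) (abelian_regular_subgroups 3)
       ({S_4, S_31, S_211} \<union> R_sub ` Fsq \<union> (if CHAR('a) = 2 then {U_13} else {}))
     \<and> alg_isomorphic class_ring (scalars_plus 4 (S_4 :: 'a mat set))
         (poly_quot 1 {t_var 1 ^ 4})
     \<and> alg_isomorphic class_ring (scalars_plus 4 (S_31 :: 'a mat set))
         (poly_quot 2 {t_var 1 ^ 3, t_var 2 ^ 2, t_var 1 * t_var 2})
     \<and> (\<forall>l \<in> Fsq. alg_isomorphic class_ring (scalars_plus 4 (R_sub l))
         (poly_quot 2 {t_var 1 ^ 2 - t_const l * t_var 2 ^ 2, t_var 1 * t_var 2}))
     \<and> (CHAR('a) = 2 \<longrightarrow> alg_isomorphic class_ring (scalars_plus 4 (U_13 :: 'a mat set))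
         (poly_quot 2 {t_var 1 ^ 2, t_var 2 ^ 2}))
     \<and> alg_isomorphic class_ring (scalars_plus 4 (S_211 :: 'a mat set))
         (let A = poly_alg 3; J = Idl\<^bsub>A\<^esub> {t_var 1, t_var 2, t_var 3}
          in quot_alg A (J \<cdot>\<^bsub>A\<^esub> J))
     \<and> indecomposable 3 (S_4 :: 'a mat set)
     \<and> (\<forall>l \<in> Fsq. indecomposable 3 (R_sub l))
     \<and> (CHAR('a) = 2 \<longrightarrow> indecomposable 3 (U_13 :: 'a mat set))"
proof (intro conjI ballI impI)
  note T = transversal_unit_squaresD[OF assms]
  show "is_complete_set_of_reps (conj_in (AGL 3)) (abelian_regular_subgroups 3)
       ({S_4, S_31, S_211} \<union> R_sub ` Fsq \<union> (if CHAR('a) = 2 then {U_13} else {}))"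
    by (rule complete_set_of_reps[OF assms])
  show "alg_isomorphic class_ring (scalars_plus 4 (S_4 :: 'a mat set)) (poly_quot 1 {t_var 1 ^ 4})"
    by (rule algebra_S_4)
  show "alg_isomorphic class_ring (scalars_plus 4 (S_31 :: 'a mat set))
      (poly_quot 2 {t_var 1 ^ 3, t_var 2 ^ 2, t_var 1 * t_var 2})"
    by (rule algebra_S_31)
  show "alg_isomorphic class_ring (scalars_plus 4 (U_13 :: 'a mat set)) (poly_quot 2 {t_var 1 ^ 2, t_var 2 ^ 2})"
    by (rule algebra_U_13)
  show "alg_isomorphic class_ring (scalars_plus 4 (S_211 :: 'a mat set))
      (let A = poly_alg 3; J = Idl\<^bsub>A\<^esub> {t_var 1, t_var 2, t_var 3} in quot_alg A (J \<cdot>\<^bsub>A\<^esub> J))"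
    by (rule algebra_S_211)
  show "indecomposable 3 (S_4 :: 'a mat set)"
    unfolding fam_instances
  proof (rule fam_indecomposable)
    fix v w :: 'a assume "v \<noteq> 0 \<or> w \<noteq> 0"
    \<comment> \<open>For \<open>v \<noteq> 0\<close> the first condition forces
      \<open>x = 0\<close>, and \<open>y\<close> meets \<open>v\<close>; for \<open>v = 0\<close> it
      is void, and \<open>x\<close> meets \<open>w\<close>.\<close>
    then show "\<exists>x y. 1 * x * v = 0 \<and> (0 * x + 1 * y) * v + (1 * x + 0 * y) * w \<noteq> 0"
    proof (cases "v = 0")
      case True
      with \<open>v \<noteq> 0 \<or> w \<noteq> 0\<close> show ?thesis by (intro exI[of _ 1] exI[of _ 0]) simp
    next
      case False
      then show ?thesis by (intro exI[of _ 0] exI[of _ 1]) simp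
    qed
  qed
  show "indecomposable 3 (U_13 :: 'a mat set)"
    unfolding fam_instances
  proof (rule fam_indecomposable)
    fix v w :: 'a assume "v \<noteq> 0 \<or> w \<noteq> 0"
    then show "\<exists>x y. 0 * x * v = 0 \<and> (0 * x + 1 * y) * v + (1 * x + 0 * y) * w \<noteq> 0"
    proof (cases "v = 0")
      case True
      with \<open>v \<noteq> 0 \<or> w \<noteq> 0\<close> show ?thesis by (intro exI[of _ 1] exI[of _ 0]) simp
    next
      case False
      then show ?thesis by (intro exI[of _ 0] exI[of _ 1]) simp
    qed
  qed
  fix l assume "l \<in> Fsq"
  then have l: "l \<noteq> 0" by (rule T(1))
  show "alg_isomorphic class_ring (scalars_plus 4 (R_sub l))
      (poly_quot 2 {t_var 1 ^ 2 - t_const l * t_var 2 ^ 2, t_var 1 * t_var 2})"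
    by (rule algebra_R_sub[OF l])
  show "indecomposable 3 (R_sub l)"
    unfolding fam_instances
  proof (rule fam_indecomposable)
    fix v w :: 'a assume "v \<noteq> 0 \<or> w \<noteq> 0"
    then consider "v \<noteq> 0" | "w \<noteq> 0" by blast
    \<comment> \<open>The form is diagonal: \<open>x\<close> meets \<open>v\<close> and
      \<open>l * y\<close> meets \<open>w\<close>, so \<open>l \<noteq> 0\<close> is what detects
      \<open>w\<close>.\<close>
    then show "\<exists>x y. 0 * x * v = 0 \<and> (1 * x + 0 * y) * v + (0 * x + l * y) * w \<noteq> 0"
    proof cases
      case 1
      then show ?thesis by (intro exI[of _ 1] exI[of _ 0]) simp
    next
      case 2
      with l show ?thesis by (intro exI[of _ 0] exI[of _ 1]) simp
    qed
  qed
qed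

end
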